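(* Let $\lambda,\mu,\xi>0$ and let $\rho(r)=\lim_{t\to+\infty}P(\mathcal N(t)=r)$, $r=0,1,\dots,N$. For $r=1,\dots,N$, $$\begin{aligned}\rho(r)={}&\Gamma\left(\tfrac{\xi}{\lambda+\mu}+1\right)\left(\frac{\lambda}{\lambda+\mu}\right)^r\binom Nr\Bigg[g(\lambda,\mu,\xi,N)\left(\frac{\mu}{\lambda+\mu}\right)\sum_{j=0}^{N-1}\left(-\frac{\mu}{\lambda+\mu}\right)^j\frac{N!\,(N-j)}{j!\,(N-j)!\,(j+1+r)}\,\frac{\Gamma(j+2+r)}{\Gamma\left(2+j+r+\frac{\xi}{\lambda+\mu}\right)}\\ &\quad\times{}_3F_2\left(\{j+1+r,-N+r,2+j+r\},\left\{1+r,2+j+r+\tfrac{\xi}{\lambda+\mu}\right\},\tfrac{\lambda}{\lambda+\mu}\right)\\ &+\sum_{j=0}^N\left(-\frac{\mu}{\lambda+\mu}\right)^j\binom Nj\frac{\Gamma(j+1+r)}{\Gamma\left(1+j+r+\frac{\xi}{\lambda+\mu}\right)}\,{}_3F_2\left(\{j+1+r,1+j+r,-N+r\},\left\{1+r,1+j+r+\tfrac{\xi}{\lambda+\mu}\right\},\tfrac{\lambda}{\lambda+\mu}\right)\Bigg].\end{aligned}$$ Moreover, for $r=0$, $$\begin{aligned}\rho(0)={}&\frac{\xi}{\xi+N(\lambda+\mu)}\,{}_3F_2\left(\left\{\tfrac12,-N,N+1\right\},\left\{1-N-\tfrac{\xi}{\lambda+\mu},1+N+\tfrac{\xi}{\lambda+\mu}\right\},\tfrac{4\lambda\mu}{(\lambda+\mu)^2}\right)\\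 &-g(\lambda,\mu,\xi,N)\,\Gamma\left(\tfrac{\xi}{\lambda+\mu}+1\right)\sum_{j=1}^N\binom Nj\left(-\frac{\mu}{\lambda+\mu}\right)^j\frac{\Gamma(j+1)}{\Gamma\left(j+1+\frac{\xi}{\lambda+\mu}\right)}\,{}_3F_2\left(\{j,1+j,-N\},\left\{1,1+j+\tfrac{\xi}{\lambda+\mu}\right\},\tfrac{\lambda}{\lambda+\mu}\right).\end{aligned}$$
   Context: Let $N,d$ be positive integers, $D=\{1,\dots,d\}$, $\lambda,\mu,\xi>0$, and let $\mathbf C=(c_{l,j})_{l,j\in D}$ be an irreducible stochastic matrix. The process $\mathbf X_t=(\mathcal N(t),J(t))$, $t\ge 0$, is the continuous-time Markov chain on $\{0,1,\dots,N\}\times D$ (first coordinate: level; second coordinate: phase) started at $(0,l_0)$ for some $l_0\in D$, with the following transition rates: from $(0,l)$ to $(1,j)$ at rate $c_{l,j}\lambda N$ for $l,j\in D$; from $(k,j)$ to $(k+1,j)$ at rate $\lambda(N-k)$ for $1\le k\le N-1$; from $(k,j)$ to $(k-1,j)$ at rate $\mu(N+k)$ for $1\le k\le N$; and, in addition, from $(k,j)$ to $(0,j)$ at rate $\xi$ for $1\le k\le N$ (catastrophe; for $k=1$ the total rate from $(1,j)$ to $(0,j)$ is $\mu(N+1)+\xi$). No other transitions occur. Notation: $(x)_i$ is the rising factorial; ${}_2F_1(a,b,c;x)=\sum_i\frac{(a)_i(b)_i}{(c)_i\,i!}x^i$; ${}_3F_2(\{a_1,a_2,a_3\},\{b_1,b_2\},x)=\sum_i\frac{(a_1)_i(a_2)_i(a_3)_i}{(b_1)_i(b_2)_i\,i!}x^i$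 (all series here terminate, having an upper parameter that is a non-positive integer); and $$g(\lambda,\mu,\xi,N)=\frac{{}_2F_1\left(\frac{\xi}{\lambda+\mu},-N,\frac{\xi}{\lambda+\mu}+N+1;-\frac\lambda\mu\right)}{{}_2F_1\left(\frac{\xi}{\lambda+\mu}+1,-N,\frac{\xi}{\lambda+\mu}+N+1;-\frac\lambda\mu\right)}.$$ *)

theory Defs
  imports "HOL-Probability.Probability"
begin

section \<open>Finite-state continuous-time Markov chains with given transition rates\<close>

text \<open>Only the off-diagonal values of \<open>q\<close> are transition rates; \<open>q x x\<close> is ignored, and the diagonal
  of the infinitesimal generator is determined by the vanishing of its row sums.\<close>

definition generator :: "'s set \<Rightarrow> ('s \<Rightarrow> 's \<Rightarrow> real) \<Rightarrow> 's \<Rightarrow> 's \<Rightarrow> real" where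
  "generator S q x y = (if x = y then - (\<Sum>z\<in>S - {x}. q x z) else q x y)"

definition transition_semigroup ::
    "'s set \<Rightarrow> ('s \<Rightarrow> 's \<Rightarrow> real) \<Rightarrow> (real \<Rightarrow> 's \<Rightarrow> 's \<Rightarrow> real) \<Rightarrow> bool" where
  "transition_semigroup S q P \<longleftrightarrow>
     (\<forall>t\<ge>0. \<forall>x\<in>S. \<forall>y\<in>S. 0 \<le> P t x y) \<and>
     (\<forall>t\<ge>0. \<forall>x\<in>S. (\<Sum>y\<in>S. P t x y) = 1) \<and>
     (\<forall>x\<in>S. \<forall>y\<in>S. P 0 x y = (if x = y then 1 else 0)) \<and>
     (\<forall>s\<ge>0. \<forall>t\<ge>0. \<forall>x\<in>S. \<forall>y\<in>S. P (s + t) x y = (\<Sum>z\<in>S. P s x z * P t z y)) \<and>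
     (\<forall>x\<in>S. \<forall>y\<in>S.
        ((\<lambda>t. P t x y) has_real_derivative generator S q x y) (at 0 within {0..}))"

text \<open>In the Markov property, \<open>T\<close> and \<open>h\<close> describe an arbitrary finite-dimensional history up to
  time \<open>s\<close>. No regularity of the sample paths is required, so in particular every
  right-continuous version of the chain is covered.\<close>

locale finite_ctmc = prob_space M for M :: "'w measure" +
  fixes S :: "'s set" and q :: "'s \<Rightarrow> 's \<Rightarrow> real" and x0 :: 's and X :: "real \<Rightarrow> 'w \<Rightarrow> 's"
  assumes finite_states: "finite S"
    and initial_state: "x0 \<in> S"
    and rv: "\<And>t. 0 \<le> t \<Longrightarrow> random_variable (count_space S) (X t)"
    and start: "AE \<omega> in M. X 0 \<omega> = x0"
    and markov: "\<exists>P. transition_semigroup S q P \<and>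
      (\<forall>s\<ge>0. \<forall>t\<ge>0. \<forall>T h. \<forall>x\<in>S. \<forall>y\<in>S. finite T \<longrightarrow> T \<subseteq> {0..s} \<longrightarrow>
         \<P>(\<omega> in M. X s \<omega> = x \<and> (\<forall>u\<in>T. X u \<omega> = h u)) > 0 \<longrightarrow>
         \<P>(\<omega> in M. X (s + t) \<omega> = y \<bar> X s \<omega> = x \<and> (\<forall>u\<in>T. X u \<omega> = h u)) = P t x y)"


section \<open>Irreducible stochastic matrices\<close>

text \<open>A \<open>d \<times> d\<close> matrix is a function of two indices in \<open>{1..d}\<close>; its values elsewhere are irrelevant.\<close>

definition stochastic_matrix :: "nat \<Rightarrow> (nat \<Rightarrow> nat \<Rightarrow> real) \<Rightarrow> bool" where
  "stochastic_matrix d C \<longleftrightarrow>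
     (\<forall>l\<in>{1..d}. \<forall>j\<in>{1..d}. 0 \<le> C l j) \<and> (\<forall>l\<in>{1..d}. (\<Sum>j=1..d. C l j) = 1)"

primrec matrix_power :: "nat \<Rightarrow> (nat \<Rightarrow> nat \<Rightarrow> real) \<Rightarrow> nat \<Rightarrow> nat \<Rightarrow> nat \<Rightarrow> real" where
  "matrix_power d C 0 = (\<lambda>l j. if l = j then 1 else 0)"
| "matrix_power d C (Suc n) = (\<lambda>l j. \<Sum>i=1..d. matrix_power d C n l i * C i j)"

definition irreducible_matrix :: "nat \<Rightarrow> (nat \<Rightarrow> nat \<Rightarrow> real) \<Rightarrow> bool" where
  "irreducible_matrix d C \<longleftrightarrow> (\<forall>l\<in>{1..d}. \<forall>j\<in>{1..d}. \<exists>n. matrix_power d C n l j > 0)"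


section \<open>The level-phase process with catastrophes\<close>

text \<open>The summands are: leaving level 0 with a phase change, level up, level down, catastrophe.
  From level 1 the last two lead to the same state and their rates add up.\<close>

fun level_phase_rate ::
    "nat \<Rightarrow> real \<Rightarrow> real \<Rightarrow> real \<Rightarrow> (nat \<Rightarrow> nat \<Rightarrow> real) \<Rightarrow> nat \<times> nat \<Rightarrow> nat \<times> nat \<Rightarrow> real" where
  "level_phase_rate N lam mu xi C (k, l) (k', j) =
     (if k = 0 \<and> k' = 1 then C l j * lam * real N else 0)
   + (if 1 \<le> k \<and> k < N \<and> k' = k + 1 \<and> j = l then lam * (real N - real k) else 0)
   + (if 1 \<le> k \<and> k \<le> N \<and> k' + 1 = k \<and> j = l then mu * (real N + real k) else 0)
   + (if 1 \<le> k \<and> k \<le> N \<and> k' = 0 \<and> j = l then xi else 0)"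


section \<open>Hypergeometric series\<close>

text \<open>In the terminating case of interest, a lower parameter may be a non-positive integer \<open>-m\<close> only
  if the numerator already vanishes from index \<open>m + 1\<close> on; the resulting terms \<open>0 / 0\<close> are \<open>0\<close>.\<close>

definition hypergeom_2F1 :: "real \<Rightarrow> real \<Rightarrow> real \<Rightarrow> real \<Rightarrow> real" where
  "hypergeom_2F1 a b c x =
     (\<Sum>i. pochhammer a i * pochhammer b i / (pochhammer c i * fact i) * x ^ i)"

definition hypergeom_3F2 :: "real \<Rightarrow> real \<Rightarrow> real \<Rightarrow> real \<Rightarrow> real \<Rightarrow> real \<Rightarrow> real" where
  "hypergeom_3F2 a1 a2 a3 b1 b2 x =
     (\<Sum>i. pochhammer a1 i * pochhammer a2 i * pochhammer a3 i /
          (pochhammer b1 i * pochhammer b2 i * fact i) * x ^ i)"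

definition g_ratio :: "real \<Rightarrow> real \<Rightarrow> real \<Rightarrow> nat \<Rightarrow> real" where
  "g_ratio lam mu xi N =
     hypergeom_2F1 (xi / (lam + mu)) (- real N) (xi / (lam + mu) + real N + 1) (- (lam / mu)) /
     hypergeom_2F1 (xi / (lam + mu) + 1) (- real N) (xi / (lam + mu) + real N + 1) (- (lam / mu))"

end

theory Submission
  imports Defs
begin

text \<open>
  Put p = lam / (lam + mu), q = mu / (lam + mu), c = xi / (lam + mu). Away from level 0, and apart
  from catastrophes, N plus the level counts the occupied units among 2N independent two-state
  units with rates lam (up) and mu (down). In the time scale w = 1 - exp (- (lam + mu) t), the
  generating function of one unit is A = z + q w (1 - z) or B = 1 - p w (1 - z), according to its
  initial state. Averaging over the exponential time of the next catastrophe, of rate c,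
  is a linear functional L in w.

  The series k(z) = L (A^N B^N) + (q N g / c) L (A^N B^N - A^(N-1) B^(N+1)) solves the balance
  equations of the free process, with sources that replace the transition from N to N - 1 at
  mass g. Comparing coefficients upwards from degree 0, all coefficients below N vanish as soon as
  the constant one does, which happens for g equal to the quotient of 2F1-series, and then the
  coefficient at N is g itself. Hence the coefficients of degree N + r form the stationary
  distribution of the level, and expanding A and B in powers of w yields the 3F2-sums.

  Convergence holds because the reversible birth-death part does not increase the squared distance
  weighted by the inverse reversible measure, while the catastrophes make it decay exponentially.
\<close>

section \<open>The resolvent of polynomial generating functions\<close>

text \<open>Moments of 1 - exp (- T) for an exponential time T of rate c.\<close>
definition exp_moment :: "real \<Rightarrow> nat \<Rightarrow> real" where
  "exp_moment c n = fact n / pochhammer (c + 1) n"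

text \<open>The outer variable is w, the inner one z.\<close>
definition resolvent :: "real \<Rightarrow> real poly poly \<Rightarrow> real poly" where
  "resolvent c F = (\<Sum>n\<le>degree F. smult (exp_moment c n) (coeff F n))"

lemma resolvent_eq_sum:
  assumes "degree F \<le> m"
  shows "resolvent c F = (\<Sum>n\<le>m. smult (exp_moment c n) (coeff F n))"
  unfolding resolvent_def
  by (rule sum.mono_neutral_left) (use assms in \<open>auto simp: coeff_eq_0\<close>)

lemma resolvent_add: "resolvent c (F + H) = resolvent c F + resolvent c H"
proof -
  let ?m = "max (degree F) (degree H)"
  have "degree (F + H) \<le> ?m"
    by (rule degree_add_le_max)
  then show ?thesis
    by (simp add: resolvent_eq_sum[of _ ?m] smult_add_right sum.distrib)
qed

lemma resolvent_monom: "resolvent c (monom a n) = smult (exp_moment c n) a"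
proof -
  have "resolvent c (monom a n) = (\<Sum>i\<le>n. smult (exp_moment c i) (coeff (monom a n) i))"
    by (rule resolvent_eq_sum) (rule degree_monom_le)
  also have "\<dots> = (\<Sum>i\<in>{n}. smult (exp_moment c i) (coeff (monom a n) i))"
    by (rule sum.mono_neutral_right) auto
  finally show ?thesis by simp
qed

lemma resolvent_0 [simp]: "resolvent c 0 = 0"
  by (simp add: resolvent_def)

lemma resolvent_sum: "resolvent c (sum f I) = (\<Sum>i\<in>I. resolvent c (f i))"
  by (induction I rule: infinite_finite_induct) (auto simp: resolvent_add)

text \<open>The functionals and derivations below are additive, so their identities need only be
  checked on monomials. The zero polynomial needs no case of its own, being the monomial with
  coefficient 0.\<close>

lemma poly_monom_add_induct:
  assumes monom: "\<And>a n. P (monom a n)"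
    and add: "\<And>F G. P F \<Longrightarrow> P G \<Longrightarrow> P (F + G)"
  shows "P (F :: 'a :: comm_monoid_add poly)"
proof -
  have "P (\<Sum>i\<in>I. monom (coeff F i) i)" if "finite I" for I
    using that
  proof (induction I)
    case empty
    show ?case using monom[of 0 0] by simp
  qed (auto intro: assms)
  from this[of "{..degree F}"] show ?thesis
    by (simp add: poly_as_sum_of_monoms)
qed

lemma resolvent_smult: "resolvent c (smult a F) = a * resolvent c F"
  by (induction F rule: poly_monom_add_induct)
     (auto simp: smult_monom resolvent_monom resolvent_add smult_add_right algebra_simps)

lemma resolvent_uminus: "resolvent c (- F) = - resolvent c F"
  using resolvent_smult[of c "-1" F] by simp

lemma resolvent_diff: "resolvent c (F - H) = resolvent c F - resolvent c H"
  using resolvent_add[of c F "- H"] by (simp add: resolvent_uminus)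

section \<open>The derivative in z and its interplay with the functional L\<close>

text \<open>The derivative in the inner variable z; plain \<open>pderiv\<close> on
  \<open>real poly poly\<close> differentiates in w.\<close>

definition inner_pderiv :: "real poly poly \<Rightarrow> real poly poly" where
  "inner_pderiv = map_poly pderiv"

lemma inner_pderiv_add: "inner_pderiv (F + H) = inner_pderiv F + inner_pderiv H"
  by (rule poly_eqI) (simp add: inner_pderiv_def coeff_map_poly pderiv_add)

lemma inner_pderiv_monom: "inner_pderiv (monom a n) = monom (pderiv a) n"
  by (rule poly_eqI) (auto simp: inner_pderiv_def coeff_map_poly)

lemma inner_pderiv_pCons: "inner_pderiv (pCons a F) = pCons (pderiv a) (inner_pderiv F)"
  by (rule poly_eqI) (simp add: inner_pderiv_def coeff_map_poly coeff_pCons split: nat.splits)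

lemma inner_pderiv_0 [simp]: "inner_pderiv 0 = 0"
  by (simp add: inner_pderiv_def)

lemma inner_pderiv_mult:
  "inner_pderiv (F * H) = F * inner_pderiv H + inner_pderiv F * H"
proof (induction F rule: poly_monom_add_induct)
  case (1 a n)
  show ?case
  proof (induction H rule: poly_monom_add_induct)
    case (1 b m)
    show ?case
      by (simp add: mult_monom inner_pderiv_monom pderiv_mult add_monom add.commute mult.commute)
  qed (simp add: inner_pderiv_add algebra_simps)
qed (simp add: inner_pderiv_add algebra_simps)

text \<open>L acts on w only, with real weights, and therefore commutes with differentiation in
  z.\<close>

lemma pderiv_resolvent: "pderiv (resolvent c F) = resolvent c (inner_pderiv F)"
  by (induction F rule: poly_monom_add_induct)
     (simp_all add: inner_pderiv_monom resolvent_monom pderiv_smult inner_pderiv_add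
        resolvent_add pderiv_add)

section \<open>Integration by parts and beta moments\<close>

lemma exp_moment_Suc:
  assumes "c > 0"
  shows "(real (Suc n) + c) * exp_moment c (Suc n) = real (Suc n) * exp_moment c n"
proof -
  have "real (Suc n) + c = c + 1 + real n" and "c + 1 + real n \<noteq> 0"
    using assms by simp_all
  then show ?thesis
    by (simp only: exp_moment_def pochhammer_Suc fact_Suc of_nat_mult) simp
qed

text \<open>L is integration over [0,1] against the density c (1 - w)^(c - 1). Integration by parts
  of (1 - w)^c F' leaves the boundary value at w = 0, which is \<open>coeff F 0\<close>. On
  monomials this is the recurrence of the moments.\<close>

lemma resolvent_by_parts:
  assumes "c > 0"
  shows "resolvent c ([:1, -1:] * pderiv F) = smult c (resolvent c F - coeff F 0)"
proof (induction F rule: poly_monom_add_induct)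
  case (1 a n)
  show ?case
  proof (cases n)
    case 0
    then show ?thesis
      by (simp add: monom_0 resolvent_monom pderiv_pCons exp_moment_def resolvent_def)
  next
    case (Suc m)
    have "[:1, -1:] * pderiv (monom a n) = monom (of_nat n * a) m - monom (of_nat n * a) n"
      by (simp add: pderiv_monom Suc) (simp add: monom_Suc)
    then have "resolvent c ([:1, -1:] * pderiv (monom a n))
        = smult (real n * exp_moment c m - real n * exp_moment c n) a"
      by (simp only: resolvent_diff resolvent_monom of_nat_poly smult_diff_left)
         (simp add: mult.commute)
    also have "real n * exp_moment c m - real n * exp_moment c n = c * exp_moment c n"
      using exp_moment_Suc[OF assms, of m] by (simp add: Suc algebra_simps)
    finally show ?thesis
      by (simp add: resolvent_monom Suc)
  qed
next
  case (2 F H)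
  then show ?case
    by (simp add: pderiv_add resolvent_add ring_distribs smult_add_right smult_diff_right
          del: mult_pCons_left)
qed

text \<open>The value of the functional at w^a (1 - w)^b.\<close>
definition beta_moment :: "real \<Rightarrow> nat \<Rightarrow> nat \<Rightarrow> real" where
  "beta_moment c a b = c * fact a / pochhammer (c + real b) (Suc a)"

lemma beta_moment_diff:
  assumes "c > 0"
  shows "beta_moment c a b - beta_moment c (Suc a) b = beta_moment c a (Suc b)"
proof -
  have pos: "pochhammer (c + real b) n > 0" "pochhammer (c + real b + 1) n > 0" for n
    using assms by (auto intro!: pochhammer_pos)
  \<comment> \<open>Splitting off the first or the last factor of the same symbol puts all three
    moments over one denominator.\<close>
  have e: "pochhammer (c + real b) (Suc (Suc a)) = (c + real b) * pochhammer (c + real b + 1) (Suc a)"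
    by (rule pochhammer_rec)
  have e': "pochhammer (c + real b) (Suc (Suc a)) = pochhammer (c + real b) (Suc a) * (c + real b + real (Suc a))"
    by (rule pochhammer_Suc)
  have "beta_moment c a b = c * fact a * (c + real b + real (Suc a)) / pochhammer (c + real b) (Suc (Suc a))"
    unfolding beta_moment_def e' using assms pos by (simp add: divide_simps)
  moreover have "beta_moment c a (Suc b) = c * fact a * (c + real b) / pochhammer (c + real b) (Suc (Suc a))"
    unfolding beta_moment_def e using assms pos by (simp add: add_ac)
  moreover have "beta_moment c (Suc a) b = c * fact a * real (Suc a) / pochhammer (c + real b) (Suc (Suc a))"
    by (simp add: beta_moment_def mult_ac)
  ultimately show ?thesis
    by (simp add: diff_divide_distrib[symmetric] algebra_simps)
qed

text \<open>Induction on b: w^a (1 - w)^(b + 1) is the difference of w^a (1 - w)^b and w^(a + 1) (1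
  - w)^b, and \<open>beta_moment_diff\<close> is the same relation between the moments.\<close>

lemma resolvent_beta:
  assumes "c > 0"
  shows "resolvent c (monom f a * [:1, -1:] ^ b) = smult (beta_moment c a b) f"
proof (induction b arbitrary: a)
  case 0
  have "c * pochhammer (c + 1) a = pochhammer c (Suc a)"
    by (simp add: pochhammer_rec)
  then have "beta_moment c a 0 = exp_moment c a"
    using assms pochhammer_pos[of "c + 1" a]
    by (simp add: beta_moment_def exp_moment_def pochhammer_rec)
  then show ?case
    by (simp add: resolvent_monom)
next
  case (Suc b)
  have "monom f a * [:1, -1:] ^ Suc b
      = monom f a * [:1, -1:] ^ b - monom f (Suc a) * [:1, -1:] ^ b"
    by (simp add: monom_Suc algebra_simps)
  then show ?case
    using beta_moment_diff[OF assms, of a b]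
    by (simp add: resolvent_diff Suc smult_diff_left[symmetric] del: mult_pCons_left power_Suc)
qed

section \<open>Generating functions of the free process\<close>

text \<open>The A of the overview: a unit that starts occupied is empty with probability q
  w.\<close>

definition gf_up :: "real \<Rightarrow> real poly poly" where
  "gf_up q = [:[:0, 1:], [:q, -q:]:]"

text \<open>The B of the overview: a unit that starts empty is occupied with probability p
  w.\<close>

definition gf_down :: "real \<Rightarrow> real poly poly" where
  "gf_down p = [:1, [:-p, p:]:]"

text \<open>Kolmogorov's forward equation for m units; since dw/dt = 1 - w in units of 1 / (lam + mu),
  the time derivative is (1 - w) times the derivative in w.\<close>
definition forward_gf :: "real \<Rightarrow> real \<Rightarrow> nat \<Rightarrow> real poly poly \<Rightarrow> bool" where
  "forward_gf p q m F \<longleftrightarrow>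
     [:1, -1:] * pderiv F
       = smult (of_nat m * [:-p, p:]) F + smult ([:1, -1:] * [:q, p:]) (inner_pderiv F)"

text \<open>Independent groups of units have multiplying generating functions: both derivatives obey
  the product rule, and the zero-order terms add up to m + n.\<close>

lemma forward_gf_mult:
  assumes "forward_gf p q m F" and "forward_gf p q n H"
  shows "forward_gf p q (m + n) (F * H)"
proof -
  have "[:1, -1:] * pderiv (F * H) = F * ([:1, -1:] * pderiv H) + ([:1, -1:] * pderiv F) * H"
    by (simp only: pderiv_mult ring_distribs mult_ac)
  also have "\<dots> = F * (smult (of_nat n * [:-p, p:]) H + smult ([:1, -1:] * [:q, p:]) (inner_pderiv H))
      + (smult (of_nat m * [:-p, p:]) F + smult ([:1, -1:] * [:q, p:]) (inner_pderiv F)) * H"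
    using assms by (simp only: forward_gf_def)
  also have "\<dots> = smult (of_nat (m + n) * [:-p, p:]) (F * H)
      + smult ([:1, -1:] * [:q, p:]) (inner_pderiv (F * H))"
    by (simp only: inner_pderiv_mult of_nat_add ring_distribs smult_add_left smult_add_right
        mult_smult_left mult_smult_right add_ac)
  finally show ?thesis
    by (simp only: forward_gf_def)
qed

lemma forward_gf_up:
  assumes "p + q = 1"
  shows "forward_gf p q 1 (gf_up q)"
proof -
  have "p = 1 - q" using assms by simp
  then show ?thesis
    unfolding \<open>p = 1 - q\<close>
    by (auto simp: forward_gf_def gf_up_def inner_pderiv_pCons pderiv_pCons algebra_simps)
qed

lemma forward_gf_down:
  assumes "p + q = 1"
  shows "forward_gf p q 1 (gf_down p)"
proof -
  have "p = 1 - q" using assms by simp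
  then show ?thesis
    unfolding \<open>p = 1 - q\<close>
    by (auto simp: forward_gf_def gf_down_def inner_pderiv_pCons pderiv_pCons algebra_simps)
qed

lemma forward_gf_power:
  assumes "forward_gf p q 1 F"
  shows "forward_gf p q m (F ^ m)"
proof (induction m)
  case 0
  show ?case
    by (simp add: forward_gf_def inner_pderiv_pCons one_pCons)
next
  case (Suc m)
  from forward_gf_mult[OF assms this] show ?case
    by simp
qed

text \<open>Applying L to the forward equation turns the time derivative into killing at rate c and
  restart from the initial generating function \<open>coeff F 0\<close>, so only an equation in z
  remains.\<close>

lemma resolvent_forward:
  assumes "c > 0" and "forward_gf p q m F"
  shows "of_nat m * [:-p, p:] * resolvent c F + [:1, -1:] * [:q, p:] * pderiv (resolvent c F)
    = smult c (resolvent c F - coeff F 0)"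
  using resolvent_by_parts[OF assms(1), of F] assms(2)
  by (simp only: forward_gf_def resolvent_add resolvent_smult pderiv_resolvent)


section \<open>The stationary generating function\<close>

text \<open>The first summand is the law, at the next catastrophe, of the free process started with
  N occupied units. The second returns to N the flow q N g that leaks down to N - 1; the division by
  c undoes the factor c in the density of L. The number g stays free until coefficient 0 is forced
  to vanish.\<close>

definition stationary_gf :: "real \<Rightarrow> real \<Rightarrow> real \<Rightarrow> nat \<Rightarrow> real \<Rightarrow> real poly" where
  "stationary_gf p q c N g =
     resolvent c (gf_up q ^ N * gf_down p ^ N)
     + smult (q * real N * g / c)
         (resolvent c (gf_up q ^ N * gf_down p ^ N - gf_up q ^ (N - 1) * gf_down p ^ Suc N))"

lemma stationary_gf_equation:
  assumes "p + q = 1" and "c > 0" and "N \<ge> 1"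
  shows "of_nat (2 * N) * [:-p, p:] * stationary_gf p q c N g
      + [:1, -1:] * [:q, p:] * pderiv (stationary_gf p q c N g)
    = smult c (stationary_gf p q c N g) - monom c N
      - (monom (q * real N * g) N - monom (q * real N * g) (N - 1))"
proof -
  \<comment> \<open>The generator of 2N free units acting on generating functions. It is linear, so
    each resolvent contributes its own initial monomial as a source.\<close>
  define T where "T F = of_nat (2 * N) * [:-p, p:] * F + [:1, -1:] * [:q, p:] * pderiv F" for F
  have T_add: "T (F + H) = T F + T H" for F H
    by (simp only: T_def pderiv_add ring_distribs add_ac)
  have T_smult: "T (smult a F) = smult a (T F)" for a F
    by (simp only: T_def pderiv_smult smult_add_right mult_smult_right)
  have T_diff: "T (F - H) = T F - T H" for F H
    using T_add[of F "smult (-1) H"] T_smult[of "-1" H] by simp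
  have T_res: "T (resolvent c (gf_up q ^ m * gf_down p ^ n))
      = smult c (resolvent c (gf_up q ^ m * gf_down p ^ n) - monom 1 m)" if "m + n = 2 * N" for m n
  proof -
    have "forward_gf p q (m + n) (gf_up q ^ m * gf_down p ^ n)"
      by (intro forward_gf_mult forward_gf_power forward_gf_up forward_gf_down assms)
    moreover have "coeff (gf_up q ^ m * gf_down p ^ n) 0 = monom 1 m"
      by (simp add: coeff_mult_0 coeff_0_power gf_up_def gf_down_def monom_altdef)
    ultimately show ?thesis
      using resolvent_forward[OF assms(2), of p q "m + n" "gf_up q ^ m * gf_down p ^ n"] that
      by (simp only: T_def)
  qed
  have "T (stationary_gf p q c N g) = smult c (stationary_gf p q c N g) - smult c (monom 1 N)
      - smult (q * real N * g / c) (smult c (monom 1 N - monom 1 (N - 1)))"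
  proof -
    let ?R1 = "resolvent c (gf_up q ^ N * gf_down p ^ N)"
    let ?R2 = "resolvent c (gf_up q ^ (N - 1) * gf_down p ^ Suc N)"
    let ?a = "q * real N * g / c"
    have "T (stationary_gf p q c N g) = T ?R1 + smult ?a (T ?R1 - T ?R2)"
      by (simp only: stationary_gf_def resolvent_diff T_add T_smult T_diff)
    also have "T ?R1 = smult c (?R1 - monom 1 N)"
      by (rule T_res) simp
    also have "T ?R2 = smult c (?R2 - monom 1 (N - 1))"
      by (rule T_res) (use assms(3) in simp)
    finally show ?thesis
      by (simp only: stationary_gf_def resolvent_diff smult_diff_right smult_add_right smult_smult
          mult.commute[of c])
  qed
  then show ?thesis
    using assms(2) by (simp add: T_def smult_diff_right smult_monom)
qed

text \<open>Coefficients of the differential equation in degree n + 1 and, separately, in degree 0,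
  where there is no lower neighbour.\<close>

lemma stationary_gf_recurrence:
  fixes p q c g :: real
  assumes "p + q = 1" and "c > 0" and "N \<ge> 1"
  defines "k \<equiv> coeff (stationary_gf p q c N g)"
  shows "p * (2 * real N - real n) * k n + q * (real n + 2) * k (Suc (Suc n))
      - (p * (2 * real N - real n - 1) + q * (real n + 1)) * k (Suc n)
    = c * k (Suc n) - (if Suc n = N then c + q * real N * g else 0)
      + (if Suc (Suc n) = N then q * real N * g else 0)"
    and "q * k 1 - 2 * real N * p * k 0
    = c * k 0 + (if N = 1 then q * real N * g else 0)"
proof -
  let ?F = "stationary_gf p q c N g"
  have e: "of_nat (2 * N) * [:-p, p:] = [:- (2 * real N * p), 2 * real N * p:]"
    by (simp add: of_nat_poly)
  have e': "[:1, -1:] * [:q, p:] = [:q, p - q, - p:]"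
    by simp
  note eq = stationary_gf_equation[OF assms(1-3), where g = g, unfolded e e']
  have "coeff ([:- (2 * real N * p), 2 * real N * p:] * ?F + [:q, p - q, - p:] * pderiv ?F) (Suc n)
    = p * (2 * real N - real n) * k n + q * (real n + 2) * k (Suc (Suc n))
      - (p * (2 * real N - real n - 1) + q * (real n + 1)) * k (Suc n)"
    by (cases n) (simp_all add: k_def coeff_pderiv algebra_simps)
  then show "p * (2 * real N - real n) * k n + q * (real n + 2) * k (Suc (Suc n))
      - (p * (2 * real N - real n - 1) + q * (real n + 1)) * k (Suc n)
    = c * k (Suc n) - (if Suc n = N then c + q * real N * g else 0)
      + (if Suc (Suc n) = N then q * real N * g else 0)"
    unfolding eq using assms(3) by (auto simp: k_def split: if_splits)
  have "coeff ([:- (2 * real N * p), 2 * real N * p:] * ?F + [:q, p - q, - p:] * pderiv ?F) 0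
    = q * k 1 - 2 * real N * p * k 0"
    by (simp add: k_def coeff_pderiv algebra_simps coeff_mult_0)
  then show "q * k 1 - 2 * real N * p * k 0
    = c * k 0 + (if N = 1 then q * real N * g else 0)"
    unfolding eq using assms(3) by (auto simp: k_def)
qed

text \<open>Each equation determines its coefficient of highest index, which carries a positive
  multiple of q. Below degree N - 1 there is no source, so zeros propagate; degree N - 1 then reads
  q N k(N) = q N g.\<close>

lemma stationary_gf_coeff_low:
  fixes p q c g :: real
  assumes "p + q = 1" and "q > 0" and "c > 0" and "N \<ge> 1"
  defines "k \<equiv> coeff (stationary_gf p q c N g)"
  assumes "k 0 = 0"
  shows "n < N \<Longrightarrow> k n = 0" and "k N = g"
proof -
  note rec = stationary_gf_recurrence[OF assms(1,3,4), where g = g, folded k_def]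
  have low: "k n = 0" if "n < N" for n
    using that
  proof (induction n rule: less_induct)
    case (less n)
    consider "n = 0" | "n = 1" | m where "n = Suc (Suc m)"
      by (metis One_nat_def not0_implies_Suc)
    then show ?case
    proof cases
      case 2
      then show ?thesis
        using rec(2) less.prems assms(2,6) by simp
    next
      case (3 m)
      then show ?thesis
        using rec(1)[of m] less.IH[of m] less.IH[of "Suc m"] less.prems assms(2) by simp
    qed (use assms in simp)
  qed
  show "k n = 0" if "n < N"
    using low that .
  show "k N = g"
  \<comment> \<open>For N = 1 the equation of degree N - 1 is the separate one of degree 0.\<close>
  proof (cases "N = 1")
    case True
    then show ?thesis
      using rec(2) assms(2,6) by simp
  next
    case False
    then obtain m where m: "N = Suc (Suc m)"
      using assms(4) by (metis One_nat_def not0_implies_Suc not_one_le_zero)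
    have "q * real N * k N = q * real N * g"
      using rec(1)[of m] low[of m] low[of "Suc m"] m by (simp add: algebra_simps)
    then show ?thesis
      using assms(2,4) by simp
  qed
qed

section \<open>Two expansions of the coefficients: in powers of w and in powers of z\<close>

lemma gf_up_power:
  "gf_up q ^ m = (\<Sum>j\<le>m. monom (smult (real (m choose j) * q ^ j)
      (monom 1 (m - j) * [:1, -1:] ^ j)) j)"
proof -
  have e: "gf_up q = monom (smult q [:1, -1:]) 1 + monom (monom 1 1) 0"
    by (simp add: gf_up_def monom_altdef)
  show ?thesis
    unfolding e binomial_ring
    by (intro sum.cong refl)
       (simp add: monom_power mult_monom smult_monom smult_power mult.commute
          of_nat_poly del: smult_pCons smult_minus_left)
qed

lemma gf_down_power:
  "gf_down p ^ n = (\<Sum>k\<le>n. monom (smult (real (n choose k) * (- p) ^ k) ([:1, -1:] ^ k)) k)"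
proof -
  have e: "gf_down p = monom (smult (- p) [:1, -1:]) 1 + 1"
    by (simp add: gf_down_def monom_altdef one_pCons)
  show ?thesis
    unfolding e binomial_ring
    by (intro sum.cong refl)
       (simp add: monom_power mult_monom smult_monom smult_power mult.commute
          of_nat_poly del: smult_pCons smult_minus_left)
qed

lemma smult_sum_right: "smult a (sum f I) = (\<Sum>i\<in>I. smult a (f i))"
  by (induction I rule: infinite_finite_induct) (auto simp: smult_add_right)

text \<open>The \<open>smult\<close> factor is (1 - z)^e, the other one (1 - w)^e. The case e = 0
  serves A^N B^N; e = 1 serves the difference in \<open>stationary_gf\<close>, since A - B = - (1 -
  z) (1 - w). In the term (j, k) the factor z^(m - j) shifts the wanted degree m + s to s +
  j.\<close>

lemma coeff_resolvent_gf:
  assumes "c > 0"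
  shows "coeff (resolvent c (smult ([:1, -1:] ^ e) (gf_up q ^ m * gf_down p ^ n * [:1, -1:] ^ e))) (m + s)
    = (\<Sum>j\<le>m. \<Sum>k\<le>n. real (m choose j) * q ^ j * real (n choose k) * (- p) ^ k * (- 1) ^ (s + j)
        * real ((j + k + e) choose (s + j)) * beta_moment c (j + k) e)"
proof -
  have shift: "smult a (monom x j * monom y k * F) = monom (a * (x * y)) (j + k) * F"
    for a x y :: "real poly" and j k F
    by (simp only: mult_monom mult_smult_left[symmetric] smult_monom)
  have "smult ([:1, -1:] ^ e) (gf_up q ^ m * gf_down p ^ n * [:1, -1:] ^ e)
    = (\<Sum>j\<le>m. \<Sum>k\<le>n. monom (smult (real (m choose j) * q ^ j * (real (n choose k) * (- p) ^ k))
          (monom 1 (m - j) * [:1, -1:] ^ (j + k + e))) (j + k) * [:1, -1:] ^ e)"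
    unfolding gf_up_power gf_down_power sum_product
    unfolding sum_distrib_right smult_sum_right
    by (intro sum.cong refl)
       (subst shift, simp only: mult_smult_left mult_smult_right smult_smult power_add mult_ac)
  then have "resolvent c (smult ([:1, -1:] ^ e) (gf_up q ^ m * gf_down p ^ n * [:1, -1:] ^ e))
    = (\<Sum>j\<le>m. \<Sum>k\<le>n. smult (beta_moment c (j + k) e)
        (smult (real (m choose j) * q ^ j * (real (n choose k) * (- p) ^ k))
          (monom 1 (m - j) * [:1, -1:] ^ (j + k + e))))"
    by (simp only: resolvent_sum resolvent_beta[OF assms])
  moreover have "coeff ([:1, -1:] ^ n) i = (- 1) ^ i * real (n choose i)" for n i
    by (cases "i \<le> n") (simp_all add: coeff_linear_poly_power coeff_eq_0 degree_linear_power)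
  moreover have "m + s - (m - j) = s + j" if "j \<le> m" for j
    using that by simp
  ultimately show ?thesis
    by (simp only: coeff_sum coeff_smult coeff_monom_mult)
       (intro sum.cong refl, auto simp: coeff_linear_poly_power mult_ac)
qed

text \<open>Polynomials in w alone.\<close>
definition const_coeffs :: "real poly poly \<Rightarrow> bool" where
  "const_coeffs F \<longleftrightarrow> inner_pderiv F = 0"

lemma const_coeffs_mult: "const_coeffs F \<Longrightarrow> const_coeffs H \<Longrightarrow> const_coeffs (F * H)"
  by (simp add: const_coeffs_def inner_pderiv_mult)

lemma const_coeffs_linear: "const_coeffs [:[:a:], [:b:]:]"
  by (simp add: const_coeffs_def inner_pderiv_pCons)

lemma const_coeffs_1: "const_coeffs 1"
  by (simp add: const_coeffs_def inner_pderiv_pCons one_pCons)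

lemma const_coeffs_power: "const_coeffs F \<Longrightarrow> const_coeffs (F ^ n)"
  by (induction n) (auto intro: const_coeffs_mult const_coeffs_1)

text \<open>L of a polynomial in w alone has vanishing z-derivative and is thus a constant, which
  the monomial moves to degree s.\<close>

lemma coeff_resolvent_const_coeffs:
  assumes "const_coeffs F"
  shows "coeff (resolvent c (smult (monom a s) F)) n = (if n = s then a * coeff (resolvent c F) 0 else 0)"
proof -
  have "pderiv (resolvent c F) = 0"
    using assms by (simp add: pderiv_resolvent const_coeffs_def)
  then obtain b where "resolvent c F = [:b:]"
    by (metis pderiv_eq_0_iff degree_eq_zeroE)
  then show ?thesis
    by (auto simp: resolvent_smult coeff_monom_mult coeff_pCons split: nat.splits)
qed

text \<open>Here the generating functions are sorted by powers of z, as z (1 - q w) + q w and z p w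
  + (1 - p w). The local \<open>A\<close> and \<open>B\<close> are the factors 1 - q w and 1 - p w,
  not the A and B of the overview.\<close>

lemma coeff_resolvent_gf_expand:
  fixes p q c :: real
  defines "A \<equiv> [:1, [:-q:]:]" and "B \<equiv> [:1, [:-p:]:]"
  shows "coeff (resolvent c (gf_up q ^ m * gf_down p ^ n)) s
    = (\<Sum>i\<le>m. \<Sum>k\<le>n. if s = i + k then real (m choose i) * real (n choose k)
        * coeff (resolvent c ((A ^ i * [:0, [:q:]:] ^ (m - i)) * ([:0, [:p:]:] ^ k * B ^ (n - k)))) 0 else 0)"
proof -
  have up: "gf_up q ^ m = (\<Sum>i\<le>m. smult (monom (real (m choose i)) i) (A ^ i * [:0, [:q:]:] ^ (m - i)))"
  proof -
    have e: "gf_up q = smult (monom 1 1) A + [:0, [:q:]:]"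
      by (simp add: gf_up_def A_def monom_altdef)
    show ?thesis
      unfolding e binomial_ring
      by (intro sum.cong refl)
         (simp add: smult_power monom_power of_nat_poly smult_monom)
  qed
  have down: "gf_down p ^ n = (\<Sum>k\<le>n. smult (monom (real (n choose k)) k) ([:0, [:p:]:] ^ k * B ^ (n - k)))"
  proof -
    have e: "gf_down p = smult (monom 1 1) [:0, [:p:]:] + B"
      by (simp add: gf_down_def B_def monom_altdef)
    show ?thesis
      unfolding e binomial_ring
      by (intro sum.cong refl)
         (simp add: smult_power monom_power of_nat_poly smult_monom del: smult_pCons)
  qed
  have const: "const_coeffs ((A ^ i * [:0, [:q:]:] ^ (m - i)) * ([:0, [:p:]:] ^ k * B ^ (n - k)))" for i k
    unfolding A_def B_def one_pCons
    by (intro const_coeffs_mult const_coeffs_power)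
       (metis const_coeffs_linear pCons_0_0)+
  show ?thesis
    unfolding up down sum_product
    unfolding mult_smult_left mult_smult_right smult_smult mult_monom resolvent_sum coeff_sum
    by (simp only: coeff_resolvent_const_coeffs[OF const])
       (intro sum.cong refl, simp add: add.commute mult.commute)
qed

text \<open>At z = 0 the two generating functions become q w and 1 - p w. Writing 1 - p w = p (1 -
  w) + q and expanding binomially leaves only beta moments.\<close>

lemma stationary_gf_coeff_0:
  fixes p q c g :: real
  assumes "p + q = 1" and "c > 0" and "N \<ge> 1"
  shows "coeff (stationary_gf p q c N g) 0
    = q ^ N * ((\<Sum>i\<le>N. real (N choose i) * p ^ i * q ^ (N - i) * beta_moment c N i)
        - real N * g / c * (\<Sum>i\<le>N. real (N choose i) * p ^ i * q ^ (N - i) * beta_moment c (N - 1) (Suc i)))"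
proof -
  let ?U = "[:1, -1:] :: real poly poly"
  let ?B' = "[:1, [:-q:]:]" and ?B = "[:1, [:-p:]:]" and ?Q = "[:0, [:q:]:]"
  \<comment> \<open>Only i = k = 0 contributes to degree 0.\<close>
  have c0: "coeff (resolvent c (gf_up q ^ m * gf_down p ^ n)) 0
      = coeff (resolvent c (?Q ^ m * ?B ^ n)) 0" for m n
  proof -
    have "coeff (resolvent c (gf_up q ^ m * gf_down p ^ n)) 0 = (\<Sum>i\<in>{..m}. if i = 0 then
        coeff (resolvent c (?Q ^ m * ?B ^ n)) 0 else 0)"
      unfolding coeff_resolvent_gf_expand
    proof (intro sum.cong refl)
      fix i
      show "(\<Sum>k\<le>n. if 0 = i + k then real (m choose i) * real (n choose k)
          * coeff (resolvent c ((?B' ^ i * ?Q ^ (m - i)) * ([:0, [:p:]:] ^ k * ?B ^ (n - k)))) 0 else 0)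
        = (if i = 0 then coeff (resolvent c (?Q ^ m * ?B ^ n)) 0 else 0)"
        by (cases "i = 0") simp_all
    qed
    then show ?thesis
      by simp
  qed
  have Q: "?Q ^ m = monom [:q ^ m:] m" for m
    by (simp add: monom_altdef[of "[:q:]" 1, simplified, symmetric] monom_power poly_const_pow)
  have B: "?B ^ N = (\<Sum>i\<le>N. smult [:real (N choose i) * p ^ i * q ^ (N - i):] (?U ^ i))"
  proof -
    have e: "?B = smult [:p:] ?U + [:[:q:]:]"
      using assms(1) by (simp add: one_pCons algebra_simps)
    show ?thesis
      unfolding e binomial_ring
      by (intro sum.cong refl)
         (simp add: smult_power poly_const_pow of_nat_poly mult_ac del: smult_pCons, simp add: mult_ac)
  qed
  have expand: "coeff (resolvent c (?Q ^ m * ?B ^ N * ?U ^ e)) 0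
      = q ^ m * (\<Sum>i\<le>N. real (N choose i) * p ^ i * q ^ (N - i) * beta_moment c m (i + e))" for m e
  proof -
    have "?Q ^ m * ?B ^ N * ?U ^ e
        = (\<Sum>i\<le>N. smult [:real (N choose i) * p ^ i * q ^ (N - i):] (monom [:q ^ m:] m * ?U ^ (i + e)))"
      unfolding Q B
      by (simp add: sum_distrib_left sum_distrib_right power_add mult_ac del: smult_pCons)
    then show ?thesis
      by (simp add: resolvent_sum resolvent_smult resolvent_beta[OF assms(2)] coeff_sum
          sum_distrib_left mult_ac del: smult_pCons)
  qed
  obtain M where M: "N = Suc M"
    using assms(3) by (cases N) auto
  have "?Q - ?B = - ?U"
    using assms(1) by (simp add: one_pCons algebra_simps)
  \<comment> \<open>The common factor is multiplied by q w - (1 - p w) = - (1 - w), which raises the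
    second beta parameter by one.\<close>
  then have red: "?Q ^ N * ?B ^ N - ?Q ^ (N - 1) * ?B ^ Suc N = - (?Q ^ (N - 1) * ?B ^ N * ?U ^ 1)"
  proof -
    have "x ^ Suc M * y ^ n - x ^ M * y ^ Suc n = - (x ^ M * y ^ n * u ^ 1)"
      if "x - y = - u" for x y u :: "real poly poly" and n
    proof -
      have u: "u = y - x" using that by (metis minus_diff_eq minus_minus)
      show ?thesis unfolding u by (simp add: algebra_simps)
    qed
    from this[OF \<open>?Q - ?B = - ?U\<close>] show ?thesis
      by (simp only: M diff_Suc_1)
  qed
  have "coeff (resolvent c (gf_up q ^ N * gf_down p ^ N - gf_up q ^ (N - 1) * gf_down p ^ Suc N)) 0
      = coeff (resolvent c (?Q ^ N * ?B ^ N - ?Q ^ (N - 1) * ?B ^ Suc N)) 0"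
    by (simp only: resolvent_diff coeff_diff c0)
  also have "\<dots> = - coeff (resolvent c (?Q ^ (N - 1) * ?B ^ N * ?U ^ 1)) 0"
    by (simp only: red resolvent_uminus coeff_minus)
  finally have "coeff (resolvent c (gf_up q ^ N * gf_down p ^ N
      - gf_up q ^ (N - 1) * gf_down p ^ Suc N)) 0
    = - (q ^ (N - 1) * (\<Sum>i\<le>N. real (N choose i) * p ^ i * q ^ (N - i)
        * beta_moment c (N - 1) (i + 1)))"
    by (simp only: expand)
  moreover have "coeff (resolvent c (gf_up q ^ N * gf_down p ^ N)) 0
    = q ^ N * (\<Sum>i\<le>N. real (N choose i) * p ^ i * q ^ (N - i) * beta_moment c N i)"
    using expand[of N 0] by (simp only: c0 power_0 mult_1_right add_0_right)
  moreover have "q ^ N = q * q ^ (N - 1)"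
    by (simp add: M)
  ultimately show ?thesis
    by (simp add: stationary_gf_def algebra_simps)
qed

section \<open>Hypergeometric expansions\<close>

text \<open>The binomial coefficient exhibits the vanishing for i > n, which truncates every series
  below to a finite sum.\<close>

lemma pochhammer_uminus_nat: "pochhammer (- real n) i = (- 1) ^ i * fact i * real (n choose i)"
proof -
  have "real (n choose i) = (- 1) ^ i * pochhammer (- real n) i / fact i"
    by (simp add: binomial_gbinomial gbinomial_pochhammer)
  then show ?thesis
    by (cases "even i") simp_all
qed

lemma hypergeom_2F1_uminus_nat:
  "hypergeom_2F1 a (- real N) b (- x) = (\<Sum>i\<le>N. real (N choose i) * x ^ i * pochhammer a i / pochhammer b i)"
proof -
  have "hypergeom_2F1 a (- real N) b (- x)
    = (\<Sum>i\<le>N. pochhammer a i * pochhammer (- real N) i / (pochhammer b i * fact i) * (- x) ^ i)"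
    unfolding hypergeom_2F1_def by (rule suminf_finite) (auto simp: pochhammer_uminus_nat)
  also have "\<dots> = (\<Sum>i\<le>N. real (N choose i) * x ^ i * pochhammer a i / pochhammer b i)"
    by (intro sum.cong refl) (simp add: pochhammer_uminus_nat power_minus[of x] field_simps)
  finally show ?thesis .
qed

text \<open>Taking q^N out of the binomial sum makes p / q the argument of the series.\<close>

lemma sum_beta_moment_2F1:
  assumes "c > 0" and "q > 0" and "\<And>i. beta_moment c m (i + e) = K * (pochhammer a i / pochhammer b i)"
  shows "(\<Sum>i\<le>N. real (N choose i) * p ^ i * q ^ (N - i) * beta_moment c m (i + e))
    = K * q ^ N * hypergeom_2F1 a (- real N) b (- (p / q))"
  unfolding hypergeom_2F1_uminus_nat sum_distrib_left
  using assms(2) by (intro sum.cong refl) (simp add: assms(3) power_divide power_diff field_simps)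

text \<open>The Pochhammer symbol of c + e with i + a + 1 factors is split once after i and once
  after a + 1 factors.\<close>

lemma beta_moment_pochhammer:
  assumes "c > 0"
  shows "beta_moment c a (i + e) = c * fact a / pochhammer (c + real e) (Suc a)
    * (pochhammer (c + real e) i / pochhammer (c + real e + real a + 1) i)"
proof -
  have "pochhammer (c + real e) (Suc a) * pochhammer (c + real e + real (Suc a)) i
      = pochhammer (c + real e) i * pochhammer (c + real e + real i) (Suc a)"
    using pochhammer_product'[of "c + real e" "Suc a" i] pochhammer_product'[of "c + real e" i "Suc a"]
    by (metis add.commute)
  moreover have "pochhammer (c + real e) i > 0"
    using assms by (intro pochhammer_pos) simp
  ultimately have "k / pochhammer (c + real e + real i) (Suc a) = k / pochhammer (c + real e) (Suc a)
      * (pochhammer (c + real e) i / pochhammer (c + real e + real (Suc a)) i)" for k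
    by (simp only: times_divide_times_eq) simp
  then show ?thesis
    by (simp add: beta_moment_def add_ac)
qed

text \<open>The quotient \<open>g_ratio\<close> in terms of p, q, c.\<close>
definition ehrenfest_ratio :: "real \<Rightarrow> real \<Rightarrow> real \<Rightarrow> nat \<Rightarrow> real" where
  "ehrenfest_ratio p q c N = hypergeom_2F1 c (- real N) (c + real N + 1) (- (p / q))
     / hypergeom_2F1 (c + 1) (- real N) (c + real N + 1) (- (p / q))"

text \<open>Coefficient 0 is the first beta sum minus N g / c times the second, up to q^N. Both then
  carry the factor q^N N! / (c + 1)_N, so vanishing means \<open>?F1 = g * ?F2\<close>, which is how
  g arises.\<close>

lemma stationary_gf_coeff_0_eq_0:
  assumes "p + q = 1" and "p > 0" and "q > 0" and "c > 0" and "N \<ge> 1"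
  shows "coeff (stationary_gf p q c N (ehrenfest_ratio p q c N)) 0 = 0"
proof -
  let ?F1 = "hypergeom_2F1 c (- real N) (c + real N + 1) (- (p / q))"
  let ?F2 = "hypergeom_2F1 (c + 1) (- real N) (c + real N + 1) (- (p / q))"
  have pos: "pochhammer (c + 1) n > 0" "pochhammer (c + real N + 1) n > 0" for n
    using assms by (intro pochhammer_pos; simp)+
  \<comment> \<open>After the signs cancel all terms are non-negative, and the term of index 0 is
    1.\<close>
  have "?F2 > 0"
    unfolding hypergeom_2F1_uminus_nat
    by (rule sum_pos2[of _ 0]) (use assms pos in \<open>auto intro!: divide_nonneg_pos mult_nonneg_nonneg simp: less_imp_le\<close>)
  have 1: "(\<Sum>i\<le>N. real (N choose i) * p ^ i * q ^ (N - i) * beta_moment c N (i + 0))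
    = (c * fact N / pochhammer c (Suc N)) * q ^ N * ?F1"
    by (rule sum_beta_moment_2F1) (use assms beta_moment_pochhammer[of c N _ 0] in simp_all)
  have 2: "(\<Sum>i\<le>N. real (N choose i) * p ^ i * q ^ (N - i) * beta_moment c (N - 1) (Suc i))
    = (c * fact (N - 1) / pochhammer (c + 1) N) * q ^ N * ?F2"
    unfolding Suc_eq_plus1
    by (rule sum_beta_moment_2F1)
       (use assms beta_moment_pochhammer[of c "N - 1" _ 1] in \<open>simp_all add: of_nat_diff add_ac\<close>)
  have "pochhammer c (Suc N) = c * pochhammer (c + 1) N"
    by (rule pochhammer_rec)
  moreover have "fact N = real N * fact (N - 1)"
    using assms(5) by (metis fact_reduce One_nat_def Suc_le_lessD)
  ultimately show ?thesis
    unfolding stationary_gf_coeff_0[OF assms(1,4,5)] 1[unfolded add_0_right] 2 ehrenfest_ratio_def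
    using \<open>?F2 > 0\<close> assms pos(1)[of N] by (simp add: field_simps)
qed

section \<open>Terminating 3F2-series and the coefficients of degree N + r\<close>

lemma exp_moment_Gamma:
  assumes "c > 0"
  shows "exp_moment c n = Gamma (c + 1) * fact n / Gamma (real n + 1 + c)"
proof -
  have "c + 1 \<notin> \<int>\<^sub>\<le>\<^sub>0"
    using assms by (auto elim!: nonpos_Ints_cases)
  then have "pochhammer (c + 1) n = Gamma (real n + 1 + c) / Gamma (c + 1)"
    by (simp add: pochhammer_Gamma add_ac)
  then show ?thesis
    by (simp add: exp_moment_def mult_ac)
qed

text \<open>Term by term, the Gamma factors absorb the Pochhammer symbols of n + 1 and n + 1 + c
  into the moment of order n + i, and (N choose r) absorbs those of r - N and 1 + r into (N choose
  (r + i)).\<close>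

lemma hypergeom_3F2_terminating:
  assumes "c > 0" and "r \<le> N"
  shows "Gamma (c + 1) * p ^ r * real (N choose r) * (Gamma (real n + 1) / Gamma (real n + 1 + c))
      * hypergeom_3F2 a (real n + 1) (real r - real N) (1 + real r) (real n + 1 + c) p
    = (\<Sum>i\<le>N - r. (- 1) ^ i * p ^ (r + i) * real (N choose (r + i)) * (pochhammer a i / fact i)
        * exp_moment c (n + i))"
proof -
  have m: "real r - real N = - real (N - r)"
    using assms(2) by (simp add: of_nat_diff)
  have "hypergeom_3F2 a (real n + 1) (real r - real N) (1 + real r) (real n + 1 + c) p
    = (\<Sum>i\<le>N - r. pochhammer a i * pochhammer (real n + 1) i * pochhammer (- real (N - r)) i
        / (pochhammer (1 + real r) i * pochhammer (real n + 1 + c) i * fact i) * p ^ i)"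
    unfolding hypergeom_3F2_def m by (rule suminf_finite) (auto simp: pochhammer_uminus_nat)
  moreover have "Gamma (c + 1) * p ^ r * real (N choose r) * (Gamma (real n + 1) / Gamma (real n + 1 + c))
      * (pochhammer a i * pochhammer (real n + 1) i * pochhammer (- real (N - r)) i
        / (pochhammer (1 + real r) i * pochhammer (real n + 1 + c) i * fact i) * p ^ i)
    = (- 1) ^ i * p ^ (r + i) * real (N choose (r + i)) * (pochhammer a i / fact i)
        * exp_moment c (n + i)" if "i \<le> N - r" for i
  proof -
    have "real n + 1 + c \<notin> \<int>\<^sub>\<le>\<^sub>0"
      using assms by (auto elim!: nonpos_Ints_cases)
    then have P1: "Gamma (real n + 1 + c) * pochhammer (real n + 1 + c) i = Gamma (real (n + i) + 1 + c)"
      using Gamma_eq_zero_iff[of "real n + 1 + c"] by (simp add: pochhammer_Gamma add_ac)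
    have fac: "fact k * pochhammer (real k + 1) i = fact (k + i)" for k
      using pochhammer_product'[of "1 :: real" k i] by (simp add: pochhammer_fact add_ac)
    have P2: "Gamma (real n + 1) * pochhammer (real n + 1) i = fact (n + i)"
      using fac[of n] Gamma_fact[of n, where ?'a = real] by (simp add: add_ac)
    have "(N choose (r + i)) * ((r + i) choose r) = (N choose r) * ((N - r) choose i)"
      using choose_mult[of r "r + i" N] that assms(2) by simp
    then have e1: "real (N choose (r + i)) * real ((r + i) choose r) = real (N choose r) * real ((N - r) choose i)"
      by (metis of_nat_mult)
    have e2: "real ((r + i) choose r) = pochhammer (1 + real r) i / fact i"
      using fac[of r] by (simp add: binomial_fact field_simps add_ac)
    have "pochhammer (1 + real r) i > 0"
      by (rule pochhammer_pos) simp
    then have P3: "real (N choose r) * real ((N - r) choose i) * fact i / pochhammer (1 + real r) i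
        = real (N choose (r + i))"
      by (simp flip: e1 add: e2)
    have "Gamma (c + 1) * p ^ r * real (N choose r) * (Gamma (real n + 1) / Gamma (real n + 1 + c))
      * (pochhammer a i * pochhammer (real n + 1) i * ((- 1) ^ i * fact i * real ((N - r) choose i))
        / (pochhammer (1 + real r) i * pochhammer (real n + 1 + c) i * fact i) * p ^ i)
      = (- 1) ^ i * p ^ (r + i) * (real (N choose r) * real ((N - r) choose i) * fact i / pochhammer (1 + real r) i)
        * (pochhammer a i / fact i)
        * (Gamma (c + 1) * (Gamma (real n + 1) * pochhammer (real n + 1) i)
            / (Gamma (real n + 1 + c) * pochhammer (real n + 1 + c) i))"
      by (simp add: power_add mult_ac)
    then show ?thesis
      unfolding P1 P2 P3 pochhammer_uminus_nat exp_moment_Gamma[OF assms(1)] .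
  qed
  ultimately show ?thesis
    by (simp add: sum_distrib_left)
qed

text \<open>The shape shared by both sums of the formula for levels: a is j + r + 1 in either sum,
  while n is j + r in the sum without g and j + r + 1 in the sum with g.\<close>

definition level_term :: "real \<Rightarrow> real \<Rightarrow> nat \<Rightarrow> nat \<Rightarrow> nat \<Rightarrow> nat \<Rightarrow> real" where
  "level_term p c N r a n = Gamma (c + 1) * p ^ r * real (N choose r)
     * (Gamma (real n + 1) / Gamma (real n + 1 + c))
     * hypergeom_3F2 (real a) (real n + 1) (real r - real N) (1 + real r) (real n + 1 + c) p"

lemma level_term_Suc:
  assumes "c > 0" and "r \<le> N"
  shows "level_term p c N r (Suc a) n = (\<Sum>i\<le>N - r. (- 1) ^ i * p ^ (r + i) * real (N choose (r + i))
    * real ((a + i) choose i) * exp_moment c (n + i))"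
proof -
  have "fact a * pochhammer (real (Suc a)) i = fact (a + i)" for i
    using pochhammer_product'[of "1 :: real" a i] by (simp add: pochhammer_fact add_ac)
  then have "pochhammer (real (Suc a)) i / fact i = real ((a + i) choose i)" for i
    by (simp add: binomial_fact field_simps)
  then show ?thesis
    using hypergeom_3F2_terminating[OF assms, of p n "real (Suc a)"]
    by (simp only: level_term_def)
qed

lemma sum_atMost_shift:
  fixes f :: "nat \<Rightarrow> 'a :: comm_monoid_add"
  assumes "r \<le> N" and "\<And>k. k < r \<Longrightarrow> f k = 0"
  shows "(\<Sum>k\<le>N. f k) = (\<Sum>i\<le>N - r. f (r + i))"
proof -
  have "(\<Sum>k\<le>N. f k) = (\<Sum>k\<in>{r..N}. f k)"
    by (rule sum.mono_neutral_right) (use assms in auto)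
  also have "\<dots> = (\<Sum>i\<le>N - r. f (r + i))"
    by (rule sum.reindex_bij_witness[of _ "\<lambda>i. r + i" "\<lambda>k. k - r"]) (use assms(1) in auto)
  finally show ?thesis .
qed

text \<open>The case e = 0, m = n = N of \<open>coeff_resolvent_gf\<close>; for fixed j the sum over
  the powers of B is one 3F2-series.\<close>

lemma coeff_resolvent_diagonal:
  assumes "c > 0" and "r \<le> N"
  shows "coeff (resolvent c (gf_up q ^ N * gf_down p ^ N)) (N + r)
    = (\<Sum>j\<le>N. (- q) ^ j * real (N choose j) * level_term p c N r (Suc (j + r)) (j + r))"
proof -
  have "coeff (resolvent c (gf_up q ^ N * gf_down p ^ N)) (N + r)
    = (\<Sum>j\<le>N. \<Sum>k\<le>N. real (N choose j) * q ^ j * real (N choose k) * (- p) ^ k * (- 1) ^ (r + j)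
        * real ((j + k) choose (r + j)) * beta_moment c (j + k) 0)"
    using coeff_resolvent_gf[OF assms(1), of 0 q N p N r] by simp
  also have "\<dots> = (\<Sum>j\<le>N. (- q) ^ j * real (N choose j) * level_term p c N r (Suc (j + r)) (j + r))"
  proof (intro sum.cong refl)
    fix j
    have b: "beta_moment c n 0 = exp_moment c n" for n
      using resolvent_beta[OF assms(1), of 1 n 0] by (simp add: resolvent_monom)
    \<comment> \<open>For k < r the coefficient ((j + k) choose (r + j)) vanishes, so k = r +
      i.\<close>
    have "(\<Sum>k\<le>N. real (N choose j) * q ^ j * real (N choose k) * (- p) ^ k * (- 1) ^ (r + j)
        * real ((j + k) choose (r + j)) * beta_moment c (j + k) 0)
      = (\<Sum>i\<le>N - r. real (N choose j) * q ^ j * real (N choose (r + i)) * (- p) ^ (r + i) * (- 1) ^ (r + j)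
        * real ((j + (r + i)) choose (r + j)) * beta_moment c (j + (r + i)) 0)"
      by (rule sum_atMost_shift) (use assms in auto)
    also have "\<dots> = (\<Sum>i\<le>N - r. (- q) ^ j * real (N choose j) * ((- 1) ^ i * p ^ (r + i)
        * real (N choose (r + i)) * real ((j + r + i) choose i) * exp_moment c (j + r + i)))"
    proof (intro sum.cong refl)
      fix i
      have "(j + r + i) choose i = (j + (r + i)) choose (r + j)"
        using binomial_symmetric[of i "j + r + i"] by (simp add: add_ac)
      moreover have "(- p) ^ (r + i) * (- 1) ^ (r + j) = (- 1) ^ i * (- 1) ^ j * p ^ (r + i)"
        by (cases "even i"; cases "even j"; cases "even r") simp_all
      moreover have "(- q) ^ j = (- 1) ^ j * q ^ j"
        by (rule power_minus)
      ultimately show "real (N choose j) * q ^ j * real (N choose (r + i)) * (- p) ^ (r + i)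
          * (- 1) ^ (r + j) * real ((j + (r + i)) choose (r + j)) * beta_moment c (j + (r + i)) 0
        = (- q) ^ j * real (N choose j) * ((- 1) ^ i * p ^ (r + i)
          * real (N choose (r + i)) * real ((j + r + i) choose i) * exp_moment c (j + r + i))"
        by (simp add: b add.assoc mult_ac)
    qed
    finally show "(\<Sum>k\<le>N. real (N choose j) * q ^ j * real (N choose k) * (- p) ^ k * (- 1) ^ (r + j)
        * real ((j + k) choose (r + j)) * beta_moment c (j + k) 0)
      = (- q) ^ j * real (N choose j) * level_term p c N r (Suc (j + r)) (j + r)"
      by (simp only: level_term_Suc[OF assms] sum_distrib_left)
  qed
  finally show ?thesis .
qed

text \<open>The difference is - (1 - z) (1 - w) A^(N - 1) B^N, the case e = 1, m = N - 1, n = N. Its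
  degree N + r is m + (r + 1), whence \<open>Suc r\<close>.\<close>

lemma coeff_resolvent_off_diagonal:
  assumes "c > 0" and "r \<le> N" and "p + q = 1" and "N \<ge> 1"
  shows "real N / c * coeff (resolvent c (gf_up q ^ N * gf_down p ^ N
      - gf_up q ^ (N - 1) * gf_down p ^ Suc N)) (N + r)
    = (\<Sum>j\<le>N - 1. (- q) ^ j * (real N * real ((N - 1) choose j) / (real j + 1 + real r))
        * level_term p c N r (Suc (j + r)) (Suc (j + r)))"
proof -
  obtain M where M: "N = Suc M"
    using assms(4) by (cases N) auto
  let ?D = "smult ([:1, -1:] ^ 1) (gf_up q ^ M * gf_down p ^ N * [:1, -1:] ^ 1)"
  have "gf_up q - gf_down p = - smult [:1, -1:] [:1, -1:]"
    using assms(3) by (simp add: gf_up_def gf_down_def one_pCons algebra_simps)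
  then have "gf_up q ^ N * gf_down p ^ N - gf_up q ^ M * gf_down p ^ Suc N
      = - (gf_up q ^ M * gf_down p ^ N * smult [:1, -1:] [:1, -1:])"
  proof -
    have "x ^ Suc M * y ^ n - x ^ M * y ^ Suc n = x ^ M * y ^ n * (x - y)"
      for x y :: "real poly poly" and n
      by (simp add: algebra_simps)
    then show ?thesis
      by (simp only: M \<open>gf_up q - gf_down p = - smult [:1, -1:] [:1, -1:]\<close> mult_minus_right)
  qed
  then have "gf_up q ^ N * gf_down p ^ N - gf_up q ^ M * gf_down p ^ Suc N = - ?D"
    by (simp only: power_one_right mult_smult_right)
  then have "coeff (resolvent c (gf_up q ^ N * gf_down p ^ N - gf_up q ^ M * gf_down p ^ Suc N)) (N + r)
      = - coeff (resolvent c ?D) (M + Suc r)"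
    by (simp only: resolvent_uminus coeff_minus) (simp add: M)
  also have "\<dots> = - (\<Sum>j\<le>M. \<Sum>k\<le>N. real (M choose j) * q ^ j * real (N choose k) * (- p) ^ k
      * (- 1) ^ (Suc r + j) * real ((j + k + 1) choose (Suc r + j)) * beta_moment c (j + k) 1)"
    by (simp only: coeff_resolvent_gf[OF assms(1)])
  finally have "real N / c * coeff (resolvent c (gf_up q ^ N * gf_down p ^ N
      - gf_up q ^ M * gf_down p ^ Suc N)) (N + r)
    = (\<Sum>j\<le>M. - (real N / c) * (\<Sum>k\<le>N. real (M choose j) * q ^ j * real (N choose k) * (- p) ^ k
      * (- 1) ^ (Suc r + j) * real ((j + k + 1) choose (Suc r + j)) * beta_moment c (j + k) 1))"
    by (simp add: sum_distrib_left sum_negf)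
  also have "\<dots> = (\<Sum>j\<le>M. (- q) ^ j * (real N * real (M choose j) / (real j + 1 + real r))
        * level_term p c N r (Suc (j + r)) (Suc (j + r)))"
  proof (intro sum.cong refl)
    fix j
    \<comment> \<open>The factor 1 - w raises the order of the moment by one and leaves a division
      by n + 1.\<close>
    have b: "beta_moment c n 1 = c * exp_moment c (Suc n) / real (Suc n)" for n
      by (simp only: beta_moment_def exp_moment_def fact_Suc of_nat_mult of_nat_1)
         (simp del: of_nat_Suc)
    have shift: "(\<Sum>k\<le>N. real (M choose j) * q ^ j * real (N choose k) * (- p) ^ k
      * (- 1) ^ (Suc r + j) * real ((j + k + 1) choose (Suc r + j)) * beta_moment c (j + k) 1)
      = (\<Sum>i\<le>N - r. real (M choose j) * q ^ j * real (N choose (r + i)) * (- p) ^ (r + i)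
      * (- 1) ^ (Suc r + j) * real ((j + (r + i) + 1) choose (Suc r + j)) * beta_moment c (j + (r + i)) 1)"
      by (rule sum_atMost_shift) (use assms in \<open>simp_all add: binomial_eq_0 del: binomial_Suc_Suc\<close>)
    have "- (real N / c) * (\<Sum>i\<le>N - r. real (M choose j) * q ^ j * real (N choose (r + i)) * (- p) ^ (r + i)
      * (- 1) ^ (Suc r + j) * real ((j + (r + i) + 1) choose (Suc r + j)) * beta_moment c (j + (r + i)) 1)
      = (\<Sum>i\<le>N - r. (- q) ^ j * (real N * real (M choose j) / (real j + 1 + real r))
        * ((- 1) ^ i * p ^ (r + i) * real (N choose (r + i)) * real ((j + r + i) choose i)
          * exp_moment c (Suc (j + r) + i)))"
      unfolding sum_distrib_left
    proof (intro sum.cong refl)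
      fix i
      \<comment> \<open>Absorption trades the division by j + r + i + 1 for one by j + r + 1, which
        no longer depends on i.\<close>
      have "Suc (j + r) * (Suc (j + r + i) choose Suc (j + r)) = Suc (j + r + i) * ((j + r + i) choose (j + r))"
        by (rule Suc_times_binomial)
      moreover have "(j + r + i) choose (j + r) = (j + r + i) choose i"
        using binomial_symmetric[of i "j + r + i"] by (simp add: add_ac)
      ultimately have "Suc (j + r) * ((j + (r + i) + 1) choose (Suc r + j)) = Suc (j + (r + i)) * ((j + r + i) choose i)"
        by (simp add: add_ac)
      then have "real (Suc (j + r)) * real ((j + (r + i) + 1) choose (Suc r + j))
          = real (Suc (j + (r + i))) * real ((j + r + i) choose i)"
        by (metis of_nat_mult)
      then have ch: "real ((j + (r + i) + 1) choose (Suc r + j)) / real (Suc (j + (r + i)))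
          = real ((j + r + i) choose i) / (real j + 1 + real r)"
        by (simp add: field_simps)
      have sg: "(- p) ^ (r + i) * (- 1) ^ (Suc r + j) = - ((- 1) ^ i * (- 1) ^ j * p ^ (r + i))"
        by (cases "even i"; cases "even j"; cases "even r") simp_all
      have "- (real N / c) * (real (M choose j) * q ^ j * real (N choose (r + i)) * (- p) ^ (r + i)
          * (- 1) ^ (Suc r + j) * real ((j + (r + i) + 1) choose (Suc r + j)) * beta_moment c (j + (r + i)) 1)
        = - real N * real (M choose j) * q ^ j * real (N choose (r + i)) * ((- p) ^ (r + i) * (- 1) ^ (Suc r + j))
          * (real ((j + (r + i) + 1) choose (Suc r + j)) / real (Suc (j + (r + i)))) * exp_moment c (Suc (j + (r + i)))"
        unfolding b using assms(1) by (simp del: of_nat_Suc)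
      also have "\<dots> = (- q) ^ j * (real N * real (M choose j) / (real j + 1 + real r))
        * ((- 1) ^ i * p ^ (r + i) * real (N choose (r + i)) * real ((j + r + i) choose i)
          * exp_moment c (Suc (j + r) + i))"
        unfolding ch sg power_minus[of q j] by (simp add: add_ac)
      finally show "- (real N / c) * (real (M choose j) * q ^ j * real (N choose (r + i)) * (- p) ^ (r + i)
          * (- 1) ^ (Suc r + j) * real ((j + (r + i) + 1) choose (Suc r + j)) * beta_moment c (j + (r + i)) 1)
        = (- q) ^ j * (real N * real (M choose j) / (real j + 1 + real r))
        * ((- 1) ^ i * p ^ (r + i) * real (N choose (r + i)) * real ((j + r + i) choose i)
          * exp_moment c (Suc (j + r) + i))" .
    qed
    then show "- (real N / c) * (\<Sum>k\<le>N. real (M choose j) * q ^ j * real (N choose k) * (- p) ^ k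
      * (- 1) ^ (Suc r + j) * real ((j + k + 1) choose (Suc r + j)) * beta_moment c (j + k) 1)
      = (- q) ^ j * (real N * real (M choose j) / (real j + 1 + real r))
        * level_term p c N r (Suc (j + r)) (Suc (j + r))"
      by (simp only: shift level_term_Suc[OF assms(1,2)] sum_distrib_left)
  qed
  finally show ?thesis
    by (simp add: M)
qed

text \<open>A product of 2N unit generating functions has degree at most 2N in z. This closes the
  balance equation at level N.\<close>

lemma stationary_gf_coeff_beyond:
  assumes "c > 0" and "p + q = 1" and "N \<ge> 1"
  shows "coeff (stationary_gf p q c N g) (N + Suc N) = 0"
proof -
  obtain M where M: "N = Suc M"
    using assms(3) by (cases N) auto
  have 1: "coeff (resolvent c (gf_up q ^ m * gf_down p ^ n)) (m + s) = 0" if "n < s" for m n s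
    using coeff_resolvent_gf[OF assms(1), of 0 q m p n s] that
    by (auto intro!: sum.neutral)
  have "coeff (resolvent c (gf_up q ^ (N - 1) * gf_down p ^ Suc N)) (N + Suc N) = 0"
    using 1[of "Suc N" "Suc (Suc N)" "N - 1"] by (simp add: M del: power_Suc)
  then show ?thesis
    using 1[of N "Suc N" N] by (simp add: stationary_gf_def resolvent_diff del: power_Suc)
qed

section \<open>The central coefficient and its 3F2-series of argument 4 p q\<close>

text \<open>Trinomial revision extracts (N choose m), and Vandermonde's convolution sums the
  rest.\<close>

lemma sum_choose_square_choose:
  assumes "m \<le> N"
  shows "(\<Sum>i\<le>N. (N choose i)\<^sup>2 * (i choose m)) = (N choose m) * ((N + (N - m)) choose (N - m))"
proof -
  have "(\<Sum>i\<le>N. (N choose i)\<^sup>2 * (i choose m)) = (\<Sum>t\<le>N - m. (N choose (m + t))\<^sup>2 * ((m + t) choose m))"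
    by (rule sum_atMost_shift) (use assms in auto)
  also have "\<dots> = (\<Sum>t\<le>N - m. (N choose m) * (((N - m) choose t) * (N choose (N - m - t))))"
  proof (intro sum.cong refl)
    fix t assume "t \<in> {..N - m}"
    then have t: "m + t \<le> N" "N - m - t = N - (m + t)"
      using assms by auto
    have "(N choose (m + t)) * ((m + t) choose m) = (N choose m) * ((N - m) choose t)"
      using choose_mult[of m "m + t" N] t(1) by simp
    moreover have "N choose (N - m - t) = N choose (m + t)"
      using binomial_symmetric[OF t(1)] t(2) by simp
    ultimately show "(N choose (m + t))\<^sup>2 * ((m + t) choose m)
        = (N choose m) * (((N - m) choose t) * (N choose (N - m - t)))"
      by (simp add: power2_eq_square mult.assoc)
  qed
  also have "\<dots> = (N choose m) * ((N - m + N) choose (N - m))"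
    by (simp only: sum_distrib_left[symmetric] vandermonde)
  finally show ?thesis
    by (simp add: add.commute)
qed

text \<open>The homogeneous form of the equality between two classical expansions of the Legendre
  polynomials.\<close>

lemma sum_choose_square_powers:
  fixes u y :: "'a :: comm_ring_1"
  shows "(\<Sum>i\<le>N. of_nat ((N choose i)\<^sup>2) * ((u + y) ^ i * y ^ (N - i)))
    = (\<Sum>k\<le>N. of_nat ((N choose k) * ((N + k) choose k)) * (y ^ k * u ^ (N - k)))"
proof -
  have "(\<Sum>i\<le>N. of_nat ((N choose i)\<^sup>2) * ((u + y) ^ i * y ^ (N - i)))
    = (\<Sum>i\<le>N. \<Sum>m\<le>N. of_nat ((N choose i)\<^sup>2 * (i choose m)) * (u ^ m * y ^ (N - m)))"
  proof (intro sum.cong refl)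
    fix i assume i: "i \<in> {..N}"
    have "(\<Sum>m\<le>N. of_nat ((N choose i)\<^sup>2 * (i choose m)) * (u ^ m * y ^ (N - m)))
      = (\<Sum>m\<le>i. of_nat ((N choose i)\<^sup>2 * (i choose m)) * (u ^ m * y ^ (N - m)))"
      by (rule sum.mono_neutral_right) (use i in \<open>simp_all add: binomial_eq_0\<close>)
    also have "\<dots> = (\<Sum>m\<le>i. of_nat ((N choose i)\<^sup>2) * ((of_nat (i choose m) * u ^ m * y ^ (i - m)) * y ^ (N - i)))"
    proof (intro sum.cong refl)
      fix m assume "m \<in> {..i}"
      then have "y ^ (N - m) = y ^ (i - m) * y ^ (N - i)"
        using i by (simp add: power_add[symmetric])
      then show "of_nat ((N choose i)\<^sup>2 * (i choose m)) * (u ^ m * y ^ (N - m))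
        = of_nat ((N choose i)\<^sup>2) * ((of_nat (i choose m) * u ^ m * y ^ (i - m)) * y ^ (N - i))"
        by (simp add: mult_ac)
    qed
    also have "\<dots> = of_nat ((N choose i)\<^sup>2) * ((u + y) ^ i * y ^ (N - i))"
      by (simp only: binomial_ring[of u y i] sum_distrib_left sum_distrib_right)
    finally show "of_nat ((N choose i)\<^sup>2) * ((u + y) ^ i * y ^ (N - i))
      = (\<Sum>m\<le>N. of_nat ((N choose i)\<^sup>2 * (i choose m)) * (u ^ m * y ^ (N - m)))" ..
  qed
  also have "\<dots> = (\<Sum>m\<le>N. of_nat (\<Sum>i\<le>N. (N choose i)\<^sup>2 * (i choose m)) * (u ^ m * y ^ (N - m)))"
    by (subst sum.swap) (simp only: of_nat_sum sum_distrib_right)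
  also have "\<dots> = (\<Sum>m\<le>N. of_nat ((N choose m) * ((N + (N - m)) choose (N - m))) * (u ^ m * y ^ (N - m)))"
    by (intro sum.cong refl) (simp only: sum_choose_square_choose atMost_iff)
  also have "\<dots> = (\<Sum>k\<le>N. of_nat ((N choose k) * ((N + k) choose k)) * (y ^ k * u ^ (N - k)))"
    by (rule sum.reindex_bij_witness[of _ "\<lambda>k. N - k" "\<lambda>m. N - m"])
       (auto simp: binomial_symmetric[symmetric] mult.commute)
  finally show ?thesis .
qed

text \<open>Degree N takes z from i factors A and N - i factors B. The resulting sum of squared
  binomials is the Legendre sum with u = 1 - w and y = p q w^2, whose other form consists of beta
  monomials.\<close>

lemma coeff_resolvent_central:
  assumes "c > 0" and "p + q = 1"
  shows "coeff (resolvent c (gf_up q ^ N * gf_down p ^ N)) N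
    = (\<Sum>k\<le>N. real (N choose k) * real ((N + k) choose k) * (p * q) ^ k * beta_moment c (2 * k) (N - k))"
proof -
  let ?A = "[:1, [:-q:]:]" and ?B = "[:1, [:-p:]:]" and ?Q = "[:0, [:q:]:]" and ?P = "[:0, [:p:]:]"
  let ?U = "[:1, -1:] :: real poly poly" and ?Y = "monom [:p * q:] 2"
  \<comment> \<open>This is (1 - q w) (1 - p w) = (1 - w) + p q w^2, by p + q = 1.\<close>
  have X: "?A * ?B = ?U + ?Y"
  proof -
    have "p = 1 - q" using assms(2) by simp
    then show ?thesis
      unfolding \<open>p = 1 - q\<close> by (simp add: monom_altdef power2_eq_square one_pCons algebra_simps)
  qed
  have Y: "?Q * ?P = ?Y"
    by (simp add: monom_altdef power2_eq_square mult.commute)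
  have "coeff (resolvent c (gf_up q ^ N * gf_down p ^ N)) N = (\<Sum>i\<le>N. real (N choose i) * real (N choose (N - i))
      * coeff (resolvent c ((?A ^ i * ?Q ^ (N - i)) * (?P ^ (N - i) * ?B ^ (N - (N - i))))) 0)"
    unfolding coeff_resolvent_gf_expand
  proof (intro sum.cong refl)
    fix i assume "i \<in> {..N}"
    then have "N = i + k \<longleftrightarrow> k = N - i" for k
      by auto
    then show "(\<Sum>k\<le>N. if N = i + k then real (N choose i) * real (N choose k)
        * coeff (resolvent c ((?A ^ i * ?Q ^ (N - i)) * (?P ^ k * ?B ^ (N - k)))) 0 else 0)
      = real (N choose i) * real (N choose (N - i))
        * coeff (resolvent c ((?A ^ i * ?Q ^ (N - i)) * (?P ^ (N - i) * ?B ^ (N - (N - i))))) 0"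
      by (simp only: sum.delta finite_atMost) simp
  qed
  also have "\<dots> = (\<Sum>i\<le>N. coeff (resolvent c (of_nat ((N choose i)\<^sup>2) * ((?U + ?Y) ^ i * ?Y ^ (N - i)))) 0)"
  proof (intro sum.cong refl)
    fix i assume i: "i \<in> {..N}"
    have "(?A ^ i * ?Q ^ (N - i)) * (?P ^ (N - i) * ?B ^ (N - (N - i))) = (?A * ?B) ^ i * (?Q * ?P) ^ (N - i)"
      using i by (simp only: power_mult_distrib mult_ac atMost_iff diff_diff_cancel)
    moreover have "of_nat k * F = smult [:real k:] F" for k and F :: "real poly poly"
      by (simp add: of_nat_poly)
    ultimately show "real (N choose i) * real (N choose (N - i))
        * coeff (resolvent c ((?A ^ i * ?Q ^ (N - i)) * (?P ^ (N - i) * ?B ^ (N - (N - i))))) 0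
      = coeff (resolvent c (of_nat ((N choose i)\<^sup>2) * ((?U + ?Y) ^ i * ?Y ^ (N - i)))) 0"
      using i binomial_symmetric[of i N] unfolding X Y
      by (simp only: resolvent_smult) (simp add: power2_eq_square)
  qed
  also have "\<dots> = coeff (resolvent c (\<Sum>k\<le>N. of_nat ((N choose k) * ((N + k) choose k)) * (?Y ^ k * ?U ^ (N - k)))) 0"
    by (simp only: sum_choose_square_powers[symmetric] resolvent_sum coeff_sum)
  also have "\<dots> = (\<Sum>k\<le>N. real (N choose k) * real ((N + k) choose k) * (p * q) ^ k * beta_moment c (2 * k) (N - k))"
    unfolding resolvent_sum coeff_sum
  proof (intro sum.cong refl)
    fix k
    have "of_nat n * (?Y ^ k * ?U ^ (N - k)) = smult [:real n:] (monom ([:p * q:] ^ k) (2 * k) * ?U ^ (N - k))" for n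
      by (simp only: monom_power) (simp add: of_nat_poly)
    then show "coeff (resolvent c (of_nat ((N choose k) * ((N + k) choose k)) * (?Y ^ k * ?U ^ (N - k)))) 0
      = real (N choose k) * real ((N + k) choose k) * (p * q) ^ k * beta_moment c (2 * k) (N - k)"
      by (simp only: resolvent_smult resolvent_beta[OF assms(1)] poly_const_pow) simp
  qed
  finally show ?thesis .
qed

text \<open>Duplication of (2 k)! yields the parameter 1/2 and the factor 4. The 2 k + 1 factors
  from c + N - k upwards split at c + N: the lower k, reversed in sign, form the symbol of 1 - N -
  c, and the upper ones give c + N and the symbol of 1 + N + c.\<close>

lemma central_sum_3F2:
  assumes "c > 0"
  shows "(\<Sum>k\<le>N. real (N choose k) * real ((N + k) choose k) * x ^ k * beta_moment c (2 * k) (N - k))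
    = c / (c + real N) * hypergeom_3F2 (1 / 2) (- real N) (real N + 1) (1 - real N - c) (1 + real N + c) (4 * x)"
proof -
  have "hypergeom_3F2 (1 / 2) (- real N) (real N + 1) (1 - real N - c) (1 + real N + c) (4 * x)
    = (\<Sum>k\<le>N. pochhammer (1 / 2) k * pochhammer (- real N) k * pochhammer (real N + 1) k /
          (pochhammer (1 - real N - c) k * pochhammer (1 + real N + c) k * fact k) * (4 * x) ^ k)"
    unfolding hypergeom_3F2_def by (rule suminf_finite) (auto simp: pochhammer_uminus_nat)
  moreover have "real (N choose k) * real ((N + k) choose k) * x ^ k * beta_moment c (2 * k) (N - k)
    = c / (c + real N) * (pochhammer (1 / 2) k * pochhammer (- real N) k * pochhammer (real N + 1) k /
          (pochhammer (1 - real N - c) k * pochhammer (1 + real N + c) k * fact k) * (4 * x) ^ k)"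
    if "k \<le> N" for k
  proof -
    let ?D = "pochhammer (c + real (N - k)) k" and ?E = "pochhammer (1 + real N + c) k"
    have pos: "?D > 0" "?E > 0" "c + real N > 0"
      using assms by (auto intro!: pochhammer_pos)
    have P1: "fact (2 * k) = 4 ^ k * pochhammer (1 / 2) k * (fact k :: real)"
      using fact_double[of k, where ?'a = real] by (simp add: power_mult)
    have "fact N * pochhammer (real N + 1) k = fact (N + k)"
      using pochhammer_product'[of "1 :: real" N k] by (simp add: pochhammer_fact add_ac)
    then have P2: "pochhammer (real N + 1) k = fact k * real ((N + k) choose k)"
      by (simp add: binomial_fact field_simps)
    have P3: "pochhammer (1 - real N - c) k = (- 1) ^ k * ?D"
      using pochhammer_minus[of "real N + c - 1" k] that by (simp add: of_nat_diff algebra_simps)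
    have "pochhammer (c + real (N - k)) (k + Suc k) = ?D * pochhammer (c + real N) (Suc k)"
      using pochhammer_product'[of "c + real (N - k)" k "Suc k"] that by (simp add: of_nat_diff)
    also have "pochhammer (c + real N) (Suc k) = (c + real N) * ?E"
      by (simp add: pochhammer_rec add_ac)
    finally have P4: "pochhammer (c + real (N - k)) (Suc (2 * k)) = ?D * ((c + real N) * ?E)"
      by (simp add: mult_2)
    show ?thesis
      unfolding beta_moment_def P1 P2 P3 P4 pochhammer_uminus_nat power_mult_distrib
      using pos by (simp add: mult_ac)
  qed
  ultimately show ?thesis
    by (simp add: sum_distrib_left)
qed

section \<open>Closed formulas for the coefficients and the balance equations\<close>

lemma hypergeom_3F2_swap: "hypergeom_3F2 a b1 b2 d e x = hypergeom_3F2 a b2 b1 d e x"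
  unfolding hypergeom_3F2_def by (simp only: mult_ac)

lemma stationary_gf_level_formula:
  assumes "c > 0" and "p + q = 1" and "N \<ge> 1" and "r \<le> N"
  shows "coeff (stationary_gf p q c N g) (N + r) =
    Gamma (c + 1) * p ^ r * real (N choose r) *
      ( g * q *
        (\<Sum>j=0..N-1. (- q) ^ j *
            (fact N * (real N - real j) / (fact j * fact (N - j) * (real j + 1 + real r))) *
            (Gamma (real j + 2 + real r) / Gamma (2 + real j + real r + c)) *
            hypergeom_3F2 (real j + 1 + real r) (- real N + real r) (2 + real j + real r)
              (1 + real r) (2 + real j + real r + c) p)
      + (\<Sum>j=0..N. (- q) ^ j * real (N choose j) *
            (Gamma (real j + 1 + real r) / Gamma (1 + real j + real r + c)) *
            hypergeom_3F2 (real j + 1 + real r) (1 + real j + real r) (- real N + real r)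
              (1 + real r) (1 + real j + real r + c) p))"
    (is "_ = ?K * (g * q * ?S1 + ?S2)")
proof -
  have diag: "?K * ?S2 = coeff (resolvent c (gf_up q ^ N * gf_down p ^ N)) (N + r)"
    unfolding coeff_resolvent_diagonal[OF assms(1,4)] sum_distrib_left atMost_atLeast0
  proof (intro sum.cong refl)
    fix j
    have e: "real (Suc (j + r)) = real j + 1 + real r" "real (j + r) + 1 = 1 + real j + real r"
      "real r - real N = - real N + real r" by simp_all
    show "?K * ((- q) ^ j * real (N choose j) *
            (Gamma (real j + 1 + real r) / Gamma (1 + real j + real r + c)) *
            hypergeom_3F2 (real j + 1 + real r) (1 + real j + real r) (- real N + real r)
              (1 + real r) (1 + real j + real r + c) p)
      = (- q) ^ j * real (N choose j) * level_term p c N r (Suc (j + r)) (j + r)"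
      unfolding level_term_def e by (simp only: add_ac mult_ac)
  qed
  have off: "?K * ?S1 = real N / c * coeff (resolvent c (gf_up q ^ N * gf_down p ^ N
      - gf_up q ^ (N - 1) * gf_down p ^ Suc N)) (N + r)"
    unfolding coeff_resolvent_off_diagonal[OF assms(1,4,2,3)] sum_distrib_left atMost_atLeast0
  proof (intro sum.cong refl)
    fix j assume "j \<in> {0..N - 1}"
    then have j: "j < N" using assms(3) by auto
    have e: "real (Suc (j + r)) = real j + 1 + real r" "real j + 1 + real r + 1 = 2 + real j + real r"
      "real r - real N = - real N + real r" "real j + 2 + real r = 2 + real j + real r" by simp_all
    have "fact N = real N * fact (N - 1)"
      using assms(3) by (metis fact_reduce One_nat_def Suc_le_lessD)
    moreover have "fact (N - j) = real (N - j) * fact (N - 1 - j)"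
      using j by (subst fact_reduce) auto
    \<comment> \<open>The factor N - j cancels one factor of (N - j)!, leaving N times ((N - 1)
      choose j).\<close>
    ultimately have ch: "fact N * (real N - real j) / (fact j * fact (N - j) * (real j + 1 + real r))
        = real N * real ((N - 1) choose j) / (real j + 1 + real r)"
      using j binomial_fact[of j "N - 1", where ?'a = real] by (simp add: of_nat_diff)
    show "?K * ((- q) ^ j *
            (fact N * (real N - real j) / (fact j * fact (N - j) * (real j + 1 + real r))) *
            (Gamma (real j + 2 + real r) / Gamma (2 + real j + real r + c)) *
            hypergeom_3F2 (real j + 1 + real r) (- real N + real r) (2 + real j + real r)
              (1 + real r) (2 + real j + real r + c) p)
      = (- q) ^ j * (real N * real ((N - 1) choose j) / (real j + 1 + real r))
        * level_term p c N r (Suc (j + r)) (Suc (j + r))"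
      unfolding ch level_term_def e
      by (subst hypergeom_3F2_swap) (simp only: mult_ac)
  qed
  have "?K * (g * q * ?S1 + ?S2) = g * q * (?K * ?S1) + ?K * ?S2"
    by (simp only: ring_distribs mult_ac)
  also have "\<dots> = coeff (stationary_gf p q c N g) (N + r)"
    unfolding diag off by (simp add: stationary_gf_def)
  finally show ?thesis ..
qed

text \<open>For r = 0 the diagonal part uses its central form. In the other part N ((N - 1) choose
  j) / (j + 1) = (N choose (j + 1)) and q (- q)^j = - (- q)^(j + 1), so shifting j by one yields a
  sum from 1 with a minus sign.\<close>

lemma stationary_gf_level_zero_formula:
  assumes "c > 0" and "p + q = 1" and "N \<ge> 1"
  shows "coeff (stationary_gf p q c N g) N =
    c / (c + real N) * hypergeom_3F2 (1 / 2) (- real N) (real N + 1)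
          (1 - real N - c) (1 + real N + c) (4 * (p * q))
      - g * Gamma (c + 1) *
        (\<Sum>j=1..N. real (N choose j) * (- q) ^ j *
            (Gamma (real j + 1) / Gamma (real j + 1 + c)) *
            hypergeom_3F2 (real j) (1 + real j) (- real N) 1 (1 + real j + c) p)"
    (is "_ = ?A - g * Gamma (c + 1) * ?S")
proof -
  have "q * (real N / c * coeff (resolvent c (gf_up q ^ N * gf_down p ^ N
      - gf_up q ^ (N - 1) * gf_down p ^ Suc N)) (N + 0))
    = (\<Sum>j\<le>N - 1. - Gamma (c + 1) * (real (N choose Suc j) * (- q) ^ Suc j *
        (Gamma (real (Suc j) + 1) / Gamma (real (Suc j) + 1 + c)) *
        hypergeom_3F2 (real (Suc j)) (1 + real (Suc j)) (- real N) 1 (1 + real (Suc j) + c) p))"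
    unfolding coeff_resolvent_off_diagonal[OF assms(1) le0 assms(2,3)] sum_distrib_left
  proof (intro sum.cong refl)
    fix j
    have "Suc j * (N choose Suc j) = N * ((N - 1) choose j)"
      using assms(3) Suc_times_binomial_eq[of "N - 1" j] by (simp add: mult.commute)
    then have "real (Suc j) * real (N choose Suc j) = real N * real ((N - 1) choose j)"
      by (metis of_nat_mult)
    then have ch: "real N * real ((N - 1) choose j) / (real j + 1 + real 0) = real (N choose Suc j)"
      by (simp add: field_simps)
    show "q * ((- q) ^ j * (real N * real ((N - 1) choose j) / (real j + 1 + real 0))
        * level_term p c N 0 (Suc (j + 0)) (Suc (j + 0)))
      = - Gamma (c + 1) * (real (N choose Suc j) * (- q) ^ Suc j *
        (Gamma (real (Suc j) + 1) / Gamma (real (Suc j) + 1 + c)) *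
        hypergeom_3F2 (real (Suc j)) (1 + real (Suc j)) (- real N) 1 (1 + real (Suc j) + c) p)"
      unfolding ch level_term_def by (simp add: add_ac)
  qed
  also have "\<dots> = - Gamma (c + 1) * ?S"
    unfolding sum_distrib_left
    by (rule sum.reindex_bij_witness[of _ "\<lambda>j. j - 1" Suc]) (use assms(3) in auto)
  finally have off: "q * (real N / c * coeff (resolvent c (gf_up q ^ N * gf_down p ^ N
      - gf_up q ^ (N - 1) * gf_down p ^ Suc N)) N) = - Gamma (c + 1) * ?S"
    by simp
  have "coeff (stationary_gf p q c N g) N = coeff (resolvent c (gf_up q ^ N * gf_down p ^ N)) N
    + g * (q * (real N / c * coeff (resolvent c (gf_up q ^ N * gf_down p ^ N
      - gf_up q ^ (N - 1) * gf_down p ^ Suc N)) N))"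
    by (simp add: stationary_gf_def)
  then show ?thesis
    unfolding off coeff_resolvent_central[OF assms(1,2)] central_sum_3F2[OF assms(1)] by simp
qed

text \<open>The recurrence read in degree N + r. The boundaries of the level range come from the
  vanishing of the coefficients N - 1 and 2 N + 1.\<close>

lemma stationary_gf_balance:
  fixes p q c :: real
  assumes "p + q = 1" and "p > 0" and "q > 0" and "c > 0" and "N \<ge> 1" and "r \<le> N"
  defines "v \<equiv> \<lambda>r. coeff (stationary_gf p q c N (ehrenfest_ratio p q c N)) (N + r)"
  shows "(if r = 0 then 0 else p * (real N - real (r - 1)) * v (r - 1))
      + (if r = N then 0 else q * (real N + real (Suc r)) * v (Suc r))
      - ((if r = N then 0 else p * (real N - real r)) + (if r = 0 then 0 else q * (real N + real r))) * v r
      - c * v r + (if r = 0 then c else 0) = 0"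
proof -
  let ?g = "ehrenfest_ratio p q c N"
  define k where "k = coeff (stationary_gf p q c N ?g)"
  have v: "v r = k (N + r)" for r
    by (simp add: v_def k_def)
  have k0: "k 0 = 0"
    unfolding k_def by (rule stationary_gf_coeff_0_eq_0[OF assms(1-5)])
  have low: "k n = 0" if "n < N" for n
    using stationary_gf_coeff_low(1)[OF assms(1,3-5), of ?g, folded k_def, OF k0 that] .
  have kN: "k N = ?g"
    using stationary_gf_coeff_low(2)[OF assms(1,3-5), of ?g, folded k_def, OF k0] .
  have beyond: "k (N + Suc N) = 0"
    unfolding k_def by (rule stationary_gf_coeff_beyond[OF assms(4,1,5)])
  note rec = stationary_gf_recurrence(1)[OF assms(1,4,5), where g = ?g, folded k_def]
  show ?thesis
  proof (cases r)
    case 0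
    \<comment> \<open>At level 0, since k(N) = g, the source q N g cancels the free down-flow q N
      k(N), and c remains as the inflow.\<close>
    obtain n where n: "N = Suc n"
      using assms(5) by (cases N) auto
    show ?thesis
      using rec[of n] low[of n] kN 0 n by (simp add: v algebra_simps)
  next
    case (Suc s)
    have F1: "p * (real N - real s) * k (N + s) + q * (real N + real s + 2) * k (Suc (Suc (N + s)))
      - (p * (real N - real s - 1) + q * (real N + real s + 1)) * k (Suc (N + s)) = c * k (Suc (N + s))"
      using rec[of "N + s"] by (simp add: algebra_simps)
    have F2: "q * (real N + real s + 2) * k (Suc (Suc (N + s)))
        = (if r = N then 0 else q * (real N + real (Suc r)) * v (Suc r))"
      using beyond Suc by (auto simp: v algebra_simps)
    have F3: "p * (real N - real s - 1) = (if r = N then 0 else p * (real N - real r))"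
      using Suc by (auto simp: algebra_simps)
    have "r - 1 = s" "v s = k (N + s)" "v r = k (Suc (N + s))" "r \<noteq> 0"
        "real N + real r = real N + real s + 1"
      by (simp_all add: v Suc)
    then show ?thesis
      using F1[unfolded F2 F3] by (cases "r = N") (simp_all add: add_ac)
  qed
qed

section \<open>Convergence of killed birth-death flows\<close>

text \<open>Abel summation, with \<open>J r\<close> as the net flux from r to r + 1.\<close>

lemma sum_by_parts_flux:
  fixes h J :: "nat \<Rightarrow> real"
  shows "(\<Sum>r\<le>n. h r * ((if r = 0 then 0 else J (r - 1)) - J r))
    = - (\<Sum>r<n. J r * (h r - h (Suc r))) - h n * J n"
  by (induction n) (simp_all add: algebra_simps)

locale birth_death =
  fixes N :: nat and up down :: "nat \<Rightarrow> real"
  assumes up_pos: "k < N \<Longrightarrow> up k > 0" and down_pos: "0 < k \<Longrightarrow> k \<le> N \<Longrightarrow> down k > 0"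
begin

text \<open>The forward equation on the levels 0 to N. Its boundaries are cut by conditionals,
  because the intended \<open>down 0\<close> is mu * N and does not vanish.\<close>

definition flow :: "(nat \<Rightarrow> real) \<Rightarrow> nat \<Rightarrow> real" where
  "flow e r = (if r = 0 then 0 else up (r - 1) * e (r - 1)) + (if r = N then 0 else down (Suc r) * e (Suc r))
     - ((if r = N then 0 else up r) + (if r = 0 then 0 else down r)) * e r"

lemma flow_diff: "flow (\<lambda>r. e r - f r) r = flow e r - flow f r"
  by (simp add: flow_def algebra_simps)

text \<open>The reversible measure, normalised to 1 at level 0.\<close>

definition weight :: "nat \<Rightarrow> real" where
  "weight k = (\<Prod>i<k. up i / down (Suc i))"

lemma weight_pos: "k \<le> N \<Longrightarrow> weight k > 0"
  unfolding weight_def by (intro prod_pos) (auto intro!: divide_pos_pos up_pos down_pos)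

lemma detailed_balance: "k < N \<Longrightarrow> weight (Suc k) * down (Suc k) = weight k * up k"
  using down_pos[of "Suc k"] by (simp add: weight_def)

text \<open>With the density h of e relative to \<open>weight\<close>, the flux across r is
  \<open>weight r * up r * (h r - h (Suc r))\<close>. By summation by parts the sum is minus the
  Dirichlet form of h; the boundary term vanishes with the flux out of N.\<close>

lemma flow_dissipative: "(\<Sum>r\<le>N. e r / weight r * flow e r) \<le> 0"
proof -
  define h where "h r = e r / weight r" for r
  define J where "J r = (if r = N then 0 else up r * e r - down (Suc r) * e (Suc r))" for r
  have e: "e r = weight r * h r" if "r \<le> N" for r
    using weight_pos[OF that] by (simp add: h_def)
  have J: "J r = weight r * up r * (h r - h (Suc r))" if "r < N" for r
    using e[of r] e[of "Suc r"] detailed_balance[OF that] that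
    by (simp add: J_def algebra_simps)
  have "(\<Sum>r\<le>N. e r / weight r * flow e r) = (\<Sum>r\<le>N. h r * ((if r = 0 then 0 else J (r - 1)) - J r))"
  proof (intro sum.cong refl)
    fix r assume "r \<in> {..N}"
    then have "flow e r = (if r = 0 then 0 else J (r - 1)) - J r"
      by (auto simp: J_def flow_def algebra_simps)
    then show "e r / weight r * flow e r = h r * ((if r = 0 then 0 else J (r - 1)) - J r)"
      by (simp only: h_def)
  qed
  also have "\<dots> = - (\<Sum>r<N. J r * (h r - h (Suc r)))"
    unfolding sum_by_parts_flux by (simp add: J_def)
  also have "\<dots> \<le> 0"
    using up_pos weight_pos by (auto intro!: sum_nonneg simp: J mult.assoc less_imp_le)
  finally show ?thesis .
qed

text \<open>The weighted square norm V is a Lyapunov function: killing contributes -2 xi V to its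
  derivative and the flow nothing positive, so V decays at least like exp (- 2 xi t).\<close>

lemma killed_flow_tendsto_0:
  fixes e :: "real \<Rightarrow> nat \<Rightarrow> real"
  assumes "xi > 0"
    and deriv: "\<And>t r. t > 0 \<Longrightarrow> r \<le> N
      \<Longrightarrow> ((\<lambda>t. e t r) has_real_derivative flow (e t) r - xi * e t r) (at t)"
    and "r \<le> N"
  shows "((\<lambda>t. e t r) \<longlongrightarrow> 0) at_top"
proof -
  define V where "V t = (\<Sum>r\<le>N. (e t r)\<^sup>2 / weight r)" for t
  \<comment> \<open>The comparison starts at time 1 because \<open>deriv\<close> speaks of t > 0
    only.\<close>
  have decr: "exp (2 * xi * t) * V t \<le> exp (2 * xi * 1) * V 1" if "t \<ge> 1" for t
  proof (rule DERIV_nonpos_imp_nonincreasing[of 1 t "\<lambda>t. exp (2 * xi * t) * V t", OF that])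
    fix s :: real assume "1 \<le> s" "s \<le> t"
    let ?D = "exp (2 * xi * s) * (2 * (\<Sum>r\<le>N. e s r / weight r * flow (e s) r))"
    have D: "((\<lambda>t. exp (2 * xi * t) * V t) has_real_derivative
        exp (2 * xi * s) * (2 * xi) * V s
        + exp (2 * xi * s) * (\<Sum>r\<le>N. 2 * e s r * (flow (e s) r - xi * e s r) / weight r)) (at s)"
      unfolding V_def using \<open>1 \<le> s\<close>
      by (auto intro!: derivative_eq_intros deriv simp: V_def weight_pos less_imp_neq[THEN not_sym] mult_ac)
    have S: "(\<Sum>r\<le>N. 2 * e s r * (flow (e s) r - xi * e s r) / weight r)
      = 2 * (\<Sum>r\<le>N. e s r / weight r * flow (e s) r) - 2 * xi * V s"
      unfolding V_def sum_distrib_left sum_subtractf[symmetric]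
      by (intro sum.cong refl)
         (simp add: right_diff_distrib diff_divide_distrib power2_eq_square mult_ac)
    have "((\<lambda>t. exp (2 * xi * t) * V t) has_real_derivative ?D) (at s)"
      using D unfolding S by (simp add: algebra_simps)
    moreover have "?D \<le> 0"
      using flow_dissipative[of "e s"] by (simp add: mult_nonneg_nonpos)
    ultimately show "\<exists>y. ((\<lambda>t. exp (2 * xi * t) * V t) has_real_derivative y) (at s) \<and> y \<le> 0"
      by blast
  qed
  define K where "K = exp (2 * xi) * V 1"
  have V_le: "V t \<le> K * exp (- (2 * xi * t))" if "t \<ge> 1" for t
    using decr[OF that] by (simp add: K_def exp_minus field_simps)
  have e_le: "(e t r)\<^sup>2 \<le> weight r * V t" for t
  proof -
    have "(e t r)\<^sup>2 / weight r \<le> V t"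
      unfolding V_def using assms(3) weight_pos
      by (intro member_le_sum) (auto intro!: divide_nonneg_pos)
    then show ?thesis
      using weight_pos[OF assms(3)] by (simp add: field_simps)
  qed
  have bound: "(e t r)\<^sup>2 \<le> weight r * (K * exp (- (2 * xi * t)))" if "t \<ge> 1" for t
    using e_le[of t] V_le[OF that] weight_pos[OF assms(3)]
    by (meson less_imp_le mult_left_mono order_trans)
  have "filterlim (\<lambda>t. - (2 * xi * t)) at_bot at_top"
    using assms(1) by (simp add: filterlim_uminus_at_bot filterlim_tendsto_pos_mult_at_top[OF tendsto_const _ filterlim_ident])
  then have "((\<lambda>t. exp (- (2 * xi * t))) \<longlongrightarrow> 0) at_top"
    by (rule filterlim_compose[OF exp_at_bot])
  then have lim: "((\<lambda>t. weight r * (K * exp (- (2 * xi * t)))) \<longlongrightarrow> 0) at_top"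
    by (intro tendsto_mult_right_zero)
  have "((\<lambda>t. (e t r)\<^sup>2) \<longlongrightarrow> 0) at_top"
    by (rule tendsto_sandwich[OF _ _ tendsto_const lim])
       (auto intro: eventually_mono[OF eventually_ge_at_top[of 1]] bound)
  from tendsto_real_sqrt[OF this] have "((\<lambda>t. \<bar>e t r\<bar>) \<longlongrightarrow> 0) at_top"
    by simp
  then show ?thesis
    by (rule tendsto_rabs_zero_cancel)
qed

end

section \<open>The level process\<close>

text \<open>The semigroup is only known to be differentiable from the right at 0. The left derivative at t
  needs left continuity at t, which follows from the incremental identity and P \<open>\<le>\<close> 1.\<close>
lemma transition_semigroup_forward:
  assumes P: "transition_semigroup S q P" and "finite S" and "x \<in> S" and "y \<in> S" and "t > 0"
  shows "((\<lambda>t. P t x y) has_real_derivative (\<Sum>z\<in>S. P t x z * generator S q z y)) (at t)"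
proof -
  let ?I = "\<lambda>x y. if x = y then 1 else 0 :: real"
  have nonneg: "P t x y \<ge> 0" and mass: "(\<Sum>y\<in>S. P t x y) = 1" if "t \<ge> 0" "x \<in> S" "y \<in> S" for t x y
    using P that by (auto simp: transition_semigroup_def)
  have P0: "P 0 x y = ?I x y" if "x \<in> S" "y \<in> S" for x y
    using P that by (auto simp: transition_semigroup_def)
  have split: "P (s + t) x y = (\<Sum>z\<in>S. P s x z * P t z y)" if "s \<ge> 0" "t \<ge> 0" "x \<in> S" "y \<in> S" for s t x y
    using P that by (auto simp: transition_semigroup_def)
  have D0: "((\<lambda>t. P t x y) has_real_derivative generator S q x y) (at 0 within {0..})" if "x \<in> S" "y \<in> S" for x y
    using P that by (auto simp: transition_semigroup_def)
  have quot: "((\<lambda>s. (P s z y - ?I z y) / s) \<longlongrightarrow> generator S q z y) (at 0 within {0..})" if "z \<in> S" "y \<in> S" for z y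
    using D0[OF that] P0[OF that] by (simp add: has_field_derivative_iff)
  have cont: "((\<lambda>s. P s z y - ?I z y) \<longlongrightarrow> 0) (at 0 within {0..})" if "z \<in> S" "y \<in> S" for z y
  proof -
    have "((\<lambda>s. P s z y) \<longlongrightarrow> P 0 z y) (at 0 within {0..})"
      using DERIV_continuous[OF D0[OF that]] by (simp add: continuous_within)
    from tendsto_diff[OF this tendsto_const[of "P 0 z y"]] show ?thesis
      using P0[OF that] by simp
  qed
  \<comment> \<open>Chapman-Kolmogorov minus multiplication by the identity matrix reduces every
    increment to the behaviour of P at time 0.\<close>
  have incr: "P (s + h) x y - P s x y = (\<Sum>z\<in>S. P s x z * (P h z y - ?I z y))"
    if "s \<ge> 0" "h \<ge> 0" "y \<in> S" for s h y
  proof -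
    have "P s x y = (\<Sum>z\<in>S. P s x z * ?I z y)"
      using that assms(2) by (simp add: if_distrib[of "\<lambda>a. _ * a"] cong: if_cong)
    then show ?thesis
      using split[OF that(1,2) assms(3) that(3)]
      by (simp only: sum_subtractf[symmetric] right_diff_distrib)
  qed
  have left: "filterlim (\<lambda>u. t - u) (at 0 within {0..}) (at_left t)"
    unfolding filterlim_at
    by (auto intro!: tendsto_eq_intros eventually_at_leftI[of "t - 1"])
  have right: "filterlim (\<lambda>u. u - t) (at 0 within {0..}) (at_right t)"
    unfolding filterlim_at
    by (auto intro!: tendsto_eq_intros eventually_at_rightI[of _ "t + 1"])
  have ev_left: "eventually (\<lambda>u. 0 < u \<and> u < t) (at_left t)"
    using assms(5) by (auto intro!: eventually_at_leftI[of 0])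
  have cont_left: "((\<lambda>u. P u x z) \<longlongrightarrow> P t x z) (at_left t)" if "z \<in> S" for z
  proof -
    have "((\<lambda>u. \<Sum>w\<in>S. \<bar>P (t - u) w z - ?I w z\<bar>) \<longlongrightarrow> (\<Sum>w\<in>S. 0)) (at_left t)"
      by (intro tendsto_sum tendsto_rabs_zero filterlim_compose[OF cont left] that)
    then have lim: "((\<lambda>u. \<Sum>w\<in>S. \<bar>P (t - u) w z - ?I w z\<bar>) \<longlongrightarrow> 0) (at_left t)"
      by simp
    have "eventually (\<lambda>u. norm (P t x z - P u x z) \<le> (\<Sum>w\<in>S. \<bar>P (t - u) w z - ?I w z\<bar>)) (at_left t)"
      using ev_left
    proof eventually_elim
      case (elim u)
      have "P t x z - P u x z = (\<Sum>w\<in>S. P u x w * (P (t - u) w z - ?I w z))"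
        using incr[of u "t - u" z] elim that by simp
      also have "norm \<dots> \<le> (\<Sum>w\<in>S. norm (P u x w * (P (t - u) w z - ?I w z)))"
        by (rule norm_sum)
      also have "\<dots> \<le> (\<Sum>w\<in>S. \<bar>P (t - u) w z - ?I w z\<bar>)"
      proof (intro sum_mono)
        fix w assume w: "w \<in> S"
        have "P u x w \<le> (\<Sum>w\<in>S. P u x w)"
          using elim assms(2,3) w by (intro member_le_sum nonneg) auto
        then have "P u x w \<le> 1" "P u x w \<ge> 0"
          using mass[of u x] nonneg[of u x w] elim assms(3) w by auto
        then show "norm (P u x w * (P (t - u) w z - ?I w z)) \<le> \<bar>P (t - u) w z - ?I w z\<bar>"
          by (simp add: abs_mult mult_left_le_one_le del: abs_minus_commute)
      qed
      finally show ?case .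
    qed
    from Lim_null_comparison[OF this lim] have "((\<lambda>u. P t x z - P u x z) \<longlongrightarrow> 0) (at_left t)" .
    from tendsto_diff[OF tendsto_const[of "P t x z"] this] show ?thesis
      by simp
  qed
  have L: "((\<lambda>u. (P u x y - P t x y) / (u - t)) \<longlongrightarrow> (\<Sum>z\<in>S. P t x z * generator S q z y)) (at_left t)"
  proof (rule Lim_transform_eventually)
    show "((\<lambda>u. \<Sum>z\<in>S. P u x z * ((P (t - u) z y - ?I z y) / (t - u)))
        \<longlongrightarrow> (\<Sum>z\<in>S. P t x z * generator S q z y)) (at_left t)"
      by (intro tendsto_sum tendsto_mult cont_left filterlim_compose[OF quot left] assms(4))
    show "eventually (\<lambda>u. (\<Sum>z\<in>S. P u x z * ((P (t - u) z y - ?I z y) / (t - u)))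
        = (P u x y - P t x y) / (u - t)) (at_left t)"
      using ev_left
    proof eventually_elim
      case (elim u)
      have "(\<Sum>z\<in>S. P u x z * ((P (t - u) z y - ?I z y) / (t - u))) = (P t x y - P u x y) / (t - u)"
        using incr[of u "t - u" y] elim assms(4) by (simp add: sum_divide_distrib)
      also have "\<dots> = (P u x y - P t x y) / (u - t)"
        by (metis minus_diff_eq minus_divide_divide)
      finally show ?case .
    qed
  qed
  have R: "((\<lambda>u. (P u x y - P t x y) / (u - t)) \<longlongrightarrow> (\<Sum>z\<in>S. P t x z * generator S q z y)) (at_right t)"
  proof (rule Lim_transform_eventually)
    show "((\<lambda>u. \<Sum>z\<in>S. P t x z * ((P (u - t) z y - ?I z y) / (u - t)))
        \<longlongrightarrow> (\<Sum>z\<in>S. P t x z * generator S q z y)) (at_right t)"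
      by (intro tendsto_sum tendsto_mult tendsto_const filterlim_compose[OF quot right] assms(4))
    show "eventually (\<lambda>u. (\<Sum>z\<in>S. P t x z * ((P (u - t) z y - ?I z y) / (u - t)))
        = (P u x y - P t x y) / (u - t)) (at_right t)"
      using eventually_at_right_less[of t]
    proof eventually_elim
      case (elim u)
      then show ?case
        using incr[of t "u - t" y] assms(4,5) by (simp add: sum_divide_distrib)
    qed
  qed
  show ?thesis
    unfolding has_field_derivative_iff filterlim_at_split using L R by blast
qed

section \<open>One-dimensional distributions and the lumping of phases\<close>

lemma (in finite_ctmc) state_event:
  assumes "t \<ge> 0" and "y \<in> S"
  shows "{\<omega> \<in> space M. X t \<omega> = y} \<in> events"
proof -
  have "X t -` {y} \<inter> space M \<in> events"
    by (rule measurable_sets[OF rv]) (use assms in auto)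
  moreover have "X t -` {y} \<inter> space M = {\<omega> \<in> space M. X t \<omega> = y}"
    by auto
  ultimately show ?thesis by simp
qed

lemma (in finite_ctmc) one_dimensional_distribution:
  obtains P where "transition_semigroup S q P"
    and "\<And>t y. t \<ge> 0 \<Longrightarrow> y \<in> S \<Longrightarrow> \<P>(\<omega> in M. X t \<omega> = y) = P t x0 y"
proof -
  obtain P where P: "transition_semigroup S q P"
    and mk: "\<forall>s\<ge>0. \<forall>t\<ge>0. \<forall>T h. \<forall>x\<in>S. \<forall>y\<in>S. finite T \<longrightarrow> T \<subseteq> {0..s} \<longrightarrow>
         \<P>(\<omega> in M. X s \<omega> = x \<and> (\<forall>u\<in>T. X u \<omega> = h u)) > 0 \<longrightarrow>
         \<P>(\<omega> in M. X (s + t) \<omega> = y \<bar> X s \<omega> = x \<and> (\<forall>u\<in>T. X u \<omega> = h u)) = P t x y"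
    by (rule exE[OF markov]) (elim conjE, rule that)
  have one: "\<P>(\<omega> in M. X 0 \<omega> = x0) = 1"
    using start state_event[of 0 x0] initial_state by (subst prob_Collect_eq_1) auto
  have "\<P>(\<omega> in M. X t \<omega> = y) = P t x0 y" if t: "t \<ge> 0" and y: "y \<in> S" for t y
  proof -
    have "\<P>(\<omega> in M. X t \<omega> = y \<and> X 0 \<omega> = x0) = \<P>(\<omega> in M. X t \<omega> = y)"
    proof (rule finite_measure_eq_AE)
      show "AE \<omega> in M. \<omega> \<in> {\<omega> \<in> space M. X t \<omega> = y \<and> X 0 \<omega> = x0}
          \<longleftrightarrow> \<omega> \<in> {\<omega> \<in> space M. X t \<omega> = y}"
        using start by eventually_elim auto
      have "{\<omega> \<in> space M. X t \<omega> = y \<and> X 0 \<omega> = x0}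
          = {\<omega> \<in> space M. X t \<omega> = y} \<inter> {\<omega> \<in> space M. X 0 \<omega> = x0}"
        by auto
      then show "{\<omega> \<in> space M. X t \<omega> = y \<and> X 0 \<omega> = x0} \<in> events"
        using state_event[OF t y] state_event[of 0 x0] initial_state by auto
    qed (rule state_event[OF t y])
    \<comment> \<open>The Markov property at time 0 with empty history; the conditioning event has
      probability 1, so it drops out.\<close>
    moreover have "\<P>(\<omega> in M. X (0 + t) \<omega> = y \<bar> X 0 \<omega> = x0 \<and> (\<forall>u\<in>{}. X u \<omega> = x0)) = P t x0 y"
      by (rule mk[rule_format]) (use t y initial_state one in auto)
    ultimately show ?thesis
      using one by (simp add: cond_prob_def)
  qed
  with P show ?thesis
    by (rule that)
qed

definition level_rate :: "nat \<Rightarrow> real \<Rightarrow> real \<Rightarrow> real \<Rightarrow> nat \<Rightarrow> nat \<Rightarrow> real" where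
  "level_rate N lam mu xi k r =
     (if r = Suc k \<and> k < N then lam * (real N - real k) else 0)
   + (if k = Suc r then mu * (real N + real k) else 0)
   + (if 1 \<le> k \<and> r = 0 then xi else 0)"

text \<open>Lumpability: the total rate from (k, l) into level r is independent of l, because the
  rows of C sum to 1 and all other transitions keep the phase.\<close>

lemma sum_phases_rate:
  assumes "stochastic_matrix d C" and "l \<in> {1..d}" and "N \<ge> 1" and "k \<le> N"
  shows "(\<Sum>j=1..d. level_phase_rate N lam mu xi C (k, l) (r, j)) = level_rate N lam mu xi k r"
proof -
  have pick: "(\<Sum>j=1..d. if A \<and> j = l then a else 0) = (if A then a else 0)" for A and a :: real
    using assms(2) by (cases A) simp_all
  have C: "(\<Sum>j=1..d. if A then C l j * lam * a else 0) = (if A then lam * a else 0)" for A a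
  proof -
    have "(\<Sum>j=1..d. C l j * lam * a) = (\<Sum>j=1..d. C l j) * lam * a"
      by (simp only: sum_distrib_right)
    then show ?thesis
      using assms(1,2) by (simp add: stochastic_matrix_def)
  qed
  have "(\<Sum>j=1..d. level_phase_rate N lam mu xi C (k, l) (r, j))
    = (if k = 0 \<and> r = 1 then lam * real N else 0)
      + (if 1 \<le> k \<and> k < N \<and> r = k + 1 then lam * (real N - real k) else 0)
      + (if 1 \<le> k \<and> k \<le> N \<and> r + 1 = k then mu * (real N + real k) else 0)
      + (if 1 \<le> k \<and> k \<le> N \<and> r = 0 then xi else 0)"
    by (simp only: level_phase_rate.simps sum.distrib C pick conj_assoc[symmetric])
  then show ?thesis
    using assms(3,4) by (auto simp: level_rate_def)
qed

text \<open>On the diagonal the value \<open>q x x\<close> cancels between the two terms, so the row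
  sum may run over all of S.\<close>

lemma generator_alt:
  assumes "finite S" and "x \<in> S"
  shows "generator S q x y = q x y - (if x = y then \<Sum>z\<in>S. q x z else 0)"
  using assms by (auto simp: generator_def sum.remove[of S x])

lemma sum_level_rate:
  assumes "r \<le> N"
  shows "(\<Sum>k\<le>N. level_rate N lam mu xi r k)
    = (if r = N then 0 else lam * (real N - real r)) + (if r = 0 then 0 else mu * (real N + real r))
      + (if r = 0 then 0 else xi)"
proof -
  have "(\<Sum>k\<le>N. if k = Suc r \<and> r < N then lam * (real N - real r) else 0)
      = (if r = N then 0 else lam * (real N - real r))"
    using assms by (cases "r = N") auto
  moreover have "(\<Sum>k\<le>N. if r = Suc k then mu * (real N + real r) else 0)
      = (if r = 0 then 0 else mu * (real N + real r))"
    using assms by (cases r) auto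
  moreover have "(\<Sum>k\<le>N. if 1 \<le> r \<and> k = 0 then xi else 0) = (if r = 0 then 0 else xi)"
    by (cases "r = 0") auto
  ultimately show ?thesis
    by (simp only: level_rate_def sum.distrib)
qed

text \<open>The inflow into level r; catastrophes bring to level 0 the mass of all other
  levels.\<close>

lemma sum_level_rate_weighted:
  assumes "r \<le> N"
  shows "(\<Sum>k\<le>N. v k * level_rate N lam mu xi k r)
    = (if r = 0 then 0 else lam * (real N - real (r - 1)) * v (r - 1))
      + (if r = N then 0 else mu * (real N + real (Suc r)) * v (Suc r))
      + (if r = 0 then xi * ((\<Sum>k\<le>N. v k) - v 0) else 0)"
proof -
  have from_below: "(\<Sum>k\<le>N. if r = Suc k \<and> k < N then v k * (lam * (real N - real k)) else 0)
      = (if r = 0 then 0 else lam * (real N - real (r - 1)) * v (r - 1))"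
  proof (cases r)
    case (Suc s)
    then have "(\<Sum>k\<le>N. if r = Suc k \<and> k < N then v k * (lam * (real N - real k)) else 0)
      = (\<Sum>k\<le>N. if k = s then v k * (lam * (real N - real k)) else 0)"
      using assms by (intro sum.cong) auto
    then show ?thesis
      using assms Suc by simp
  qed simp
  have from_above: "(\<Sum>k\<le>N. if k = Suc r then v k * (mu * (real N + real k)) else 0)
      = (if r = N then 0 else mu * (real N + real (Suc r)) * v (Suc r))"
    using assms by (auto simp: mult_ac)
  have catastrophe: "(\<Sum>k\<le>N. if 1 \<le> k \<and> r = 0 then v k * xi else 0)
      = (if r = 0 then xi * ((\<Sum>k\<le>N. v k) - v 0) else 0)"
  proof (cases "r = 0")
    case True
    have "(\<Sum>k\<le>N. if 1 \<le> k then v k * xi else 0) = (\<Sum>k\<in>{..N} - {0}. v k * xi)"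
      by (rule sum.mono_neutral_cong_right) auto
    also have "\<dots> = xi * ((\<Sum>k\<le>N. v k) - v 0)"
      by (simp add: sum_diff1 sum_distrib_left right_diff_distrib mult.commute)
    finally show ?thesis
      using True by simp
  qed simp
  have split: "v k * level_rate N lam mu xi k r = (if r = Suc k \<and> k < N then v k * (lam * (real N - real k)) else 0)
      + (if k = Suc r then v k * (mu * (real N + real k)) else 0)
      + (if 1 \<le> k \<and> r = 0 then v k * xi else 0)" for k
    by (simp only: level_rate_def distrib_left if_distrib[of "(*) (v k)"] mult_zero_right)
  show ?thesis
    unfolding split sum.distrib from_below from_above catastrophe ..
qed

section \<open>Forward equation and limit of the level distribution\<close>

locale level_phase_chain = finite_ctmc M "{0..N} \<times> {1..d}" "level_phase_rate N lam mu xi C" "(0, l0)" X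
  for M :: "'w measure" and N d lam mu xi C l0 and X :: "real \<Rightarrow> 'w \<Rightarrow> nat \<times> nat" +
  assumes N_pos: "N \<ge> 1" and rates_pos: "lam > 0" "mu > 0" "xi > 0" and stochastic: "stochastic_matrix d C"
begin

sublocale levels: birth_death N "\<lambda>k. lam * (real N - real k)" "\<lambda>k. mu * (real N + real k)"
  by unfold_locales (use rates_pos in auto)

definition level_prob :: "real \<Rightarrow> nat \<Rightarrow> real" where
  "level_prob t r = \<P>(\<omega> in M. fst (X t \<omega>) = r)"

text \<open>The forward equations of the chain are summed over the phases of level r. Total mass 1
  turns the inflow xi (1 - P(0)) at level 0 into a constant source xi together with killing at rate
  xi, so that all levels are killed alike.\<close>

lemma level_prob_forward:
  assumes "t > 0" and "r \<le> N"
  shows "((\<lambda>t. level_prob t r) has_real_derivative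
    levels.flow (level_prob t) r - xi * level_prob t r + (if r = 0 then xi else 0)) (at t)"
proof -
  let ?S = "{0..N} \<times> {1..d}" and ?q = "level_phase_rate N lam mu xi C"
  obtain P where P: "transition_semigroup ?S ?q P"
    and dist: "\<And>t y. t \<ge> 0 \<Longrightarrow> y \<in> ?S \<Longrightarrow> \<P>(\<omega> in M. X t \<omega> = y) = P t (0, l0) y"
    using one_dimensional_distribution by blast
  have level: "level_prob t r = (\<Sum>j=1..d. P t (0, l0) (r, j))" if "t \<ge> 0" "r \<le> N" for t r
  proof -
    have in_S: "X t \<omega> \<in> ?S" if "\<omega> \<in> space M" for \<omega>
      using measurable_space[OF rv[OF \<open>t \<ge> 0\<close>] that] by simp
    have "fst (X t \<omega>) = r \<longleftrightarrow> (\<exists>j\<in>{1..d}. X t \<omega> = (r, j))" if "\<omega> \<in> space M" for \<omega>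
      using in_S[OF that] by (cases "X t \<omega>") auto
    then have "{\<omega> \<in> space M. fst (X t \<omega>) = r} = (\<Union>j\<in>{1..d}. {\<omega> \<in> space M. X t \<omega> = (r, j)})"
      by blast
    moreover have "{\<omega> \<in> space M. X t \<omega> = y} \<in> events" if "y \<in> ?S" for y
      using \<open>t \<ge> 0\<close> that by (rule state_event)
    ultimately have "level_prob t r = (\<Sum>j=1..d. \<P>(\<omega> in M. X t \<omega> = (r, j)))"
      unfolding level_prob_def using that
      by (simp only:) (rule finite_measure_finite_Union, auto simp: disjoint_family_on_def)
    then show ?thesis
      using dist that by simp
  qed
  have mass: "(\<Sum>k\<le>N. level_prob t k) = 1"
  proof -
    have "(\<Sum>k\<le>N. level_prob t k) = (\<Sum>k\<in>{0..N}. \<Sum>j\<in>{1..d}. P t (0, l0) (k, j))"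
      using assms(1) by (simp add: level atMost_atLeast0)
    also have "\<dots> = (\<Sum>y\<in>?S. P t (0, l0) y)"
      by (simp add: sum.cartesian_product)
    also have "\<dots> = 1"
      using P assms(1) initial_state by (simp only: transition_semigroup_def)
    finally show ?thesis .
  qed
  have gen: "(\<Sum>j=1..d. generator ?S ?q (k, l) (r, j)) = level_rate N lam mu xi k r
      - (if k = r then \<Sum>s\<le>N. level_rate N lam mu xi k s else 0)" if "k \<le> N" "l \<in> {1..d}" for k l
  proof -
    have "(\<Sum>z\<in>?S. ?q (k, l) z) = (\<Sum>s\<in>{0..N}. \<Sum>j\<in>{1..d}. ?q (k, l) (s, j))"
      by (simp only: sum.cartesian_product case_prod_unfold prod.collapse)
    also have "\<dots> = (\<Sum>s\<le>N. level_rate N lam mu xi k s)"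
      using that by (simp only: sum_phases_rate[OF stochastic that(2) N_pos that(1)] atMost_atLeast0)
    finally have total: "(\<Sum>z\<in>?S. ?q (k, l) z) = (\<Sum>s\<le>N. level_rate N lam mu xi k s)" .
    have "(\<Sum>j=1..d. generator ?S ?q (k, l) (r, j))
      = (\<Sum>j=1..d. ?q (k, l) (r, j) - (if k = r \<and> j = l then \<Sum>s\<le>N. level_rate N lam mu xi k s else 0))"
    proof (intro sum.cong refl)
      fix j
      have "(k, l) \<in> ?S" using that by auto
      then show "generator ?S ?q (k, l) (r, j)
        = ?q (k, l) (r, j) - (if k = r \<and> j = l then \<Sum>s\<le>N. level_rate N lam mu xi k s else 0)"
        by (subst generator_alt[OF finite_states]) (auto simp only: total prod.inject split: if_splits)
    qed
    also have "\<dots> = level_rate N lam mu xi k r - (if k = r then \<Sum>s\<le>N. level_rate N lam mu xi k s else 0)"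
      unfolding sum_subtractf sum_phases_rate[OF stochastic that(2) N_pos that(1)]
      using that(2) by (cases "k = r") simp_all
    finally show ?thesis .
  qed
  have D: "((\<lambda>t. \<Sum>j=1..d. P t (0, l0) (r, j)) has_real_derivative
      (\<Sum>j=1..d. \<Sum>z\<in>?S. P t (0, l0) z * generator ?S ?q z (r, j))) (at t)"
    using assms(2)
    by (intro DERIV_sum transition_semigroup_forward[OF P finite_states initial_state _ assms(1)]) auto
  \<comment> \<open>The representation by P holds for non-negative times, hence in a neighbourhood
    of t > 0, and the derivative carries over.\<close>
  have ev: "eventually (\<lambda>s. level_prob s r = (\<Sum>j=1..d. P s (0, l0) (r, j))) (nhds t)"
    by (rule eventually_mono[OF eventually_nhds_in_open[of "{0<..}" t]])
       (use assms in \<open>auto intro!: level simp del: One_nat_def\<close>)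
  have "((\<lambda>t. level_prob t r) has_real_derivative
      (\<Sum>j=1..d. \<Sum>z\<in>?S. P t (0, l0) z * generator ?S ?q z (r, j))) (at t)"
    by (rule iffD2[OF DERIV_cong_ev[OF refl ev refl] D])
  also have "(\<Sum>j=1..d. \<Sum>z\<in>?S. P t (0, l0) z * generator ?S ?q z (r, j))
    = (\<Sum>z\<in>?S. P t (0, l0) z * (\<Sum>j=1..d. generator ?S ?q z (r, j)))"
    by (subst sum.swap) (simp only: sum_distrib_left)
  also have "\<dots> = (\<Sum>k\<in>{0..N}. \<Sum>l\<in>{1..d}. P t (0, l0) (k, l) * (\<Sum>j=1..d. generator ?S ?q (k, l) (r, j)))"
    by (simp only: sum.cartesian_product case_prod_unfold prod.collapse)
  also have "\<dots> = (\<Sum>k\<in>{0..N}. \<Sum>l\<in>{1..d}. P t (0, l0) (k, l) * (level_rate N lam mu xi k r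
      - (if k = r then \<Sum>s\<le>N. level_rate N lam mu xi k s else 0)))"
    by (intro sum.cong refl) (simp only: gen atLeastAtMost_iff)
  also have "\<dots> = (\<Sum>k\<le>N. level_prob t k * (level_rate N lam mu xi k r
      - (if k = r then \<Sum>s\<le>N. level_rate N lam mu xi k s else 0)))"
    unfolding atMost_atLeast0 sum_distrib_right[symmetric]
    by (intro sum.cong refl) (use assms(1) in \<open>simp only: level less_imp_le atLeastAtMost_iff\<close>)
  also have "\<dots> = (\<Sum>k\<le>N. level_prob t k * level_rate N lam mu xi k r)
      - (\<Sum>k\<le>N. if k = r then level_prob t r * (\<Sum>s\<le>N. level_rate N lam mu xi r s) else 0)"
    unfolding sum_subtractf[symmetric] by (intro sum.cong refl) (simp add: right_diff_distrib)
  also have "\<dots> = (\<Sum>k\<le>N. level_prob t k * level_rate N lam mu xi k r)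
      - level_prob t r * (\<Sum>s\<le>N. level_rate N lam mu xi r s)"
    using assms(2) by simp
  also have "\<dots> = levels.flow (level_prob t) r - xi * level_prob t r + (if r = 0 then xi else 0)"
    unfolding sum_level_rate_weighted[OF assms(2)] sum_level_rate[OF assms(2)] mass levels.flow_def
    by (cases "r = 0"; cases "r = N") (simp_all add: algebra_simps)
  finally show ?thesis .
qed

text \<open>The source xi at level 0 cancels in the difference from v, which therefore solves the
  homogeneous killed flow and tends to 0.\<close>

lemma level_prob_tendsto:
  assumes balance: "\<And>r. r \<le> N \<Longrightarrow> levels.flow v r - xi * v r + (if r = 0 then xi else 0) = 0" and "r \<le> N"
  shows "((\<lambda>t. \<P>(\<omega> in M. fst (X t \<omega>) = r)) \<longlongrightarrow> v r) at_top"
proof -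
  have "((\<lambda>t. level_prob t r - v r) \<longlongrightarrow> 0) at_top"
  proof (rule levels.killed_flow_tendsto_0[OF rates_pos(3) _ assms(2)])
    fix t :: real and r assume t: "t > 0" and r: "r \<le> N"
    have "levels.flow (level_prob t) r - xi * level_prob t r + (if r = 0 then xi else 0)
      = levels.flow (\<lambda>r. level_prob t r - v r) r - xi * (level_prob t r - v r)"
      using balance[OF r] unfolding levels.flow_diff right_diff_distrib[of xi] by linarith
    then show "((\<lambda>t. level_prob t r - v r) has_real_derivative
        levels.flow (\<lambda>r. level_prob t r - v r) r - xi * (level_prob t r - v r)) (at t)"
      using DERIV_diff[OF level_prob_forward[OF t r] DERIV_const[of "v r"]] by simp
  qed
  from tendsto_add[OF this tendsto_const[of "v r"]] show ?thesis
    by (simp add: level_prob_def)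
qed

end

section \<open>The limit formulas in the original parameters\<close>

theorem proposition4p2:
  fixes N d :: nat and lam mu xi :: real and C :: "nat \<Rightarrow> nat \<Rightarrow> real" and l0 :: nat
    and M :: "'w measure" and X :: "real \<Rightarrow> 'w \<Rightarrow> nat \<times> nat"
  assumes "N \<ge> 1" and "d \<ge> 1" and "lam > 0" and "mu > 0" and "xi > 0"
    and "stochastic_matrix d C" and "irreducible_matrix d C"
    and "l0 \<in> {1..d}"
    and "finite_ctmc M ({0..N} \<times> {1..d}) (level_phase_rate N lam mu xi C) (0, l0) X"
  shows "(\<forall>r\<in>{1..N}. ((\<lambda>t. \<P>(\<omega> in M. fst (X t \<omega>) = r)) \<longlongrightarrow>
      Gamma (xi / (lam + mu) + 1) * (lam / (lam + mu)) ^ r * real (N choose r) *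
      ( g_ratio lam mu xi N * (mu / (lam + mu)) *
        (\<Sum>j=0..N-1. (- (mu / (lam + mu))) ^ j *
            (fact N * (real N - real j) / (fact j * fact (N - j) * (real j + 1 + real r))) *
            (Gamma (real j + 2 + real r) / Gamma (2 + real j + real r + xi / (lam + mu))) *
            hypergeom_3F2 (real j + 1 + real r) (- real N + real r) (2 + real j + real r)
              (1 + real r) (2 + real j + real r + xi / (lam + mu)) (lam / (lam + mu)))
      + (\<Sum>j=0..N. (- (mu / (lam + mu))) ^ j * real (N choose j) *
            (Gamma (real j + 1 + real r) / Gamma (1 + real j + real r + xi / (lam + mu))) *
            hypergeom_3F2 (real j + 1 + real r) (1 + real j + real r) (- real N + real r)
              (1 + real r) (1 + real j + real r + xi / (lam + mu)) (lam / (lam + mu))))) at_top) \<and>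
    ((\<lambda>t. \<P>(\<omega> in M. fst (X t \<omega>) = 0)) \<longlongrightarrow>
      xi / (xi + real N * (lam + mu)) *
        hypergeom_3F2 (1 / 2) (- real N) (real N + 1)
          (1 - real N - xi / (lam + mu)) (1 + real N + xi / (lam + mu))
          (4 * lam * mu / (lam + mu)\<^sup>2)
      - g_ratio lam mu xi N * Gamma (xi / (lam + mu) + 1) *
        (\<Sum>j=1..N. real (N choose j) * (- (mu / (lam + mu))) ^ j *
            (Gamma (real j + 1) / Gamma (real j + 1 + xi / (lam + mu))) *
            hypergeom_3F2 (real j) (1 + real j) (- real N)
              1 (1 + real j + xi / (lam + mu)) (lam / (lam + mu)))) at_top"
proof -
  interpret level_phase_chain M N d lam mu xi C l0 X
    by (intro level_phase_chain.intro level_phase_chain_axioms.intro assms)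
  define p q c where "p = lam / (lam + mu)" and "q = mu / (lam + mu)" and "c = xi / (lam + mu)"
  note pqc = p_def q_def c_def
  have s: "lam + mu > 0"
    using assms(3,4) by simp
  have pos: "p > 0" "q > 0" "c > 0"
    using assms(3-5) s by (simp_all add: pqc)
  have pq: "p + q = 1"
    using s by (simp add: pqc add_divide_distrib[symmetric])
  have rates: "lam = (lam + mu) * p" "mu = (lam + mu) * q" "xi = (lam + mu) * c"
    using s by (simp_all add: pqc)
  have g: "g_ratio lam mu xi N = ehrenfest_ratio p q c N"
    using s by (simp add: g_ratio_def ehrenfest_ratio_def pqc)
  define v where "v r = coeff (stationary_gf p q c N (ehrenfest_ratio p q c N)) (N + r)" for r
  have balance: "levels.flow v r - xi * v r + (if r = 0 then xi else 0) = 0" if "r \<le> N" for r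
  proof -
    \<comment> \<open>The change of time scale by lam + mu. It is stated for independent a, b, x, K,
      as rewriting directly with \<open>rates\<close>, where lam and mu recur on the right, would
      loop.\<close>
    have scale: "(if r = 0 then 0 else a * (real N - real (r - 1)) * v (r - 1))
        + (if r = N then 0 else b * (real N + real (Suc r)) * v (Suc r))
        - ((if r = N then 0 else a * (real N - real r)) + (if r = 0 then 0 else b * (real N + real r))) * v r
        - x * v r + (if r = 0 then x else 0)
      = K * ((if r = 0 then 0 else p * (real N - real (r - 1)) * v (r - 1))
        + (if r = N then 0 else q * (real N + real (Suc r)) * v (Suc r))
        - ((if r = N then 0 else p * (real N - real r)) + (if r = 0 then 0 else q * (real N + real r))) * v r
        - c * v r + (if r = 0 then c else 0))"
      if "a = K * p" "b = K * q" "x = K * c" for a b x K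
      unfolding that by (cases "r = 0"; cases "r = N"; simp add: algebra_simps)
    have "levels.flow v r - xi * v r + (if r = 0 then xi else 0)
      = (lam + mu) * ((if r = 0 then 0 else p * (real N - real (r - 1)) * v (r - 1))
        + (if r = N then 0 else q * (real N + real (Suc r)) * v (Suc r))
        - ((if r = N then 0 else p * (real N - real r)) + (if r = 0 then 0 else q * (real N + real r))) * v r
        - c * v r + (if r = 0 then c else 0))"
      unfolding levels.flow_def by (rule scale[OF rates])
    also have "\<dots> = 0"
      using stationary_gf_balance[OF pq pos assms(1) that]
      by (simp only: v_def mult_zero_right)
    finally show ?thesis .
  qed
  have lim: "((\<lambda>t. \<P>(\<omega> in M. fst (X t \<omega>) = r)) \<longlongrightarrow> v r) at_top" if "r \<le> N" for r
    using balance that by (rule level_prob_tendsto)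
  have "c + real N = (xi + real N * (lam + mu)) / (lam + mu)"
    using s by (simp add: c_def add_divide_distrib)
  \<comment> \<open>Only the argument and the prefactor of the first 3F2-series at level 0 need
    conversion; everything else unfolds to p, q, c.\<close>
  then have e: "4 * lam * mu / (lam + mu)\<^sup>2 = 4 * (p * q)" "xi / (xi + real N * (lam + mu)) = c / (c + real N)"
    using s by (simp_all add: pqc power2_eq_square)
  show ?thesis
  proof (intro conjI ballI, goal_cases)
    case (1 r)
    then have r: "r \<le> N" by simp
    show ?case
      using lim[OF r] unfolding v_def g pqc[symmetric] stationary_gf_level_formula[OF pos(3) pq assms(1) r] .
  next
    case 2
    show ?case
      using lim[OF le0] unfolding v_def g e pqc[symmetric] add_0_right
        stationary_gf_level_zero_formula[OF pos(3) pq assms(1)] .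
  qed
qed

end
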